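(* If $n=pq$, with $p$ and $q$ distinct odd primes, then every Reinhardt polygon with $n$ sides is periodic, that is, $E_1(n)=0$.
   Context: A Reuleaux polygon is a closed convex region in the plane of constant width whose boundary consists of a finite number of circular arcs, each with the same curvature; its vertices are the points where two adjacent arcs of its boundary meet (there is an odd number of them). Connecting all pairs of vertices of a Reuleaux polygon $R$ at maximal distance from one another gives a star polygon $S$: a closed path consisting of an odd number of line segments, each intersecting all the others, all of length equal to the diameter of $R$; the angles at its vertices sum to $\pi$. Let $n\ge 3$ be an integer, not a power of two. A Reinhardt polygon with $n$ sides is an equilateral convex $n$-gon $P$ that can be inscribed in a Reuleaux polygon $R$ having the same diameter as $P$ in such a way that every vertex of $R$ is a vertex of $P$. If $S$ has $r$ vertices ($r$ odd), the angle of $S$ at each vertex $v$ equals $k\pi/n$, where $k$ is the number of sides of $P$ inscribed in the arc of $R$ opposite $v$. Reading off these integers while traversing $S$ gives a composition $[k_1,\dots,k_r]$ of $n$ into an odd number $r$ of positive parts. Two compositions are equivalent if one is obtained from the other by a combination of cyclic shifts and list reversals (corresponding to rotations and flips of the polygon); an equivalence class is called a dihedral composition. Characterization (Reinhardt): a composition $[k_1,\dots,k_r]$ of $n$ with $r$ odd corresponds to a Reinhardt polygon if and only if $\Phi_{2n}(z)$ divides $F(z)=1-z^{k_1}+z^{k_1+k_2}-\cdots+z^{k_1+\cdots+k_{r-1}}$, where $\Phi_m$ is the $m$th cyclotomic polynomial. A Reinhardt polygon is periodic if its dihedral composition is periodic, i.e. has the form $[(k_1,\dots,k_s)^d]$ (the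 list $k_1,\dots,k_s$ repeated $d$ times) for some integer $d>1$; otherwise it is sporadic. $E_1(n)$ denotes the number of sporadic Reinhardt polygons with $n$ sides, two polygons being counted as distinct only if one cannot be obtained from the other by a combination of rotations and flips (i.e. one counts the corresponding dihedral compositions). *)

theory Defs
  imports "HOL-Analysis.Analysis" "HOL-Computational_Algebra.Primes"
begin

text \<open>The Euclidean plane is the type \<^typ>\<open>complex\<close>.\<close>

section \<open>Reuleaux polygons\<close>

definition directional_width :: "complex \<Rightarrow> complex set \<Rightarrow> real" where
  "directional_width u S = (SUP x\<in>S. inner u x) - (INF x\<in>S. inner u x)"

definition constant_width :: "complex set \<Rightarrow> bool" where
  "constant_width S \<longleftrightarrow> (\<exists>w. \<forall>u. norm u = 1 \<longrightarrow> directional_width u S = w)"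

text \<open>Nondegenerate circular arcs of radius \<open>\<rho>\<close>; a full circle counts as an arc.\<close>

definition circular_arc :: "real \<Rightarrow> complex set \<Rightarrow> bool" where
  "circular_arc \<rho> A \<longleftrightarrow> \<rho> > 0 \<and>
     (\<exists>c a b. a < b \<and> b \<le> a + 2 * pi \<and> A = (\<lambda>t. c + of_real \<rho> * cis t) ` {a..b})"

text \<open>
  The boundary arcs are taken to be the maximal ones, so that subdividing an arc
  does not create spurious vertices.
\<close>

definition boundary_arcs :: "complex set \<Rightarrow> complex set set" where
  "boundary_arcs R =
     {A. (\<exists>\<rho>. circular_arc \<rho> A) \<and> A \<subseteq> frontier R \<and>
         (\<forall>B. (\<exists>\<rho>. circular_arc \<rho> B) \<and> A \<subseteq> B \<and> B \<subseteq> frontier R \<longrightarrow> B = A)}"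

definition reuleaux_vertices :: "complex set \<Rightarrow> complex set" where
  "reuleaux_vertices R =
     {x. \<exists>A\<in>boundary_arcs R. \<exists>B\<in>boundary_arcs R. A \<noteq> B \<and> x \<in> A \<and> x \<in> B}"

text \<open>
  The number of vertices is automatically odd as soon as there is a vertex at all;
  the last clause only excludes the disc, whose boundary is a single arc without vertices.
\<close>

definition reuleaux_polygon :: "complex set \<Rightarrow> bool" where
  "reuleaux_polygon R \<longleftrightarrow>
     compact R \<and> convex R \<and> constant_width R \<and>
     finite (boundary_arcs R) \<and> frontier R = \<Union>(boundary_arcs R) \<and>
     (\<exists>\<rho>. \<forall>A\<in>boundary_arcs R. circular_arc \<rho> A) \<and>
     odd (card (reuleaux_vertices R))"

text \<open>
  The segments of the star polygon, each given as the pair of its endpoints, and the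
  lists of vertices encountered when the star polygon is traversed once as a closed path.
\<close>

definition star_segments :: "complex set \<Rightarrow> complex set set" where
  "star_segments R =
     {{u, v} | u v. u \<in> reuleaux_vertices R \<and> v \<in> reuleaux_vertices R \<and> dist u v = diameter R}"

definition star_traversal :: "complex set \<Rightarrow> complex list \<Rightarrow> bool" where
  "star_traversal R vs \<longleftrightarrow>
     distinct vs \<and> set vs = reuleaux_vertices R \<and>
     {{vs ! i, vs ! (Suc i mod length vs)} | i. i < length vs} = star_segments R"

text \<open>
  The arc of a Reuleaux polygon opposite to a vertex \<open>v\<close> is centred at \<open>v\<close>, with radius
  the diameter, and it comprises all points of the boundary at that distance from \<open>v\<close>.
\<close>

definition opposite_arc :: "complex set \<Rightarrow> complex \<Rightarrow> complex set" where
  "opposite_arc R v = {x \<in> frontier R. dist v x = diameter R}"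

section \<open>Reinhardt polygons\<close>

definition vertices :: "complex set \<Rightarrow> complex set" where
  "vertices P = {x. x extreme_point_of P}"

definition sides :: "complex set \<Rightarrow> complex set set" where
  "sides P = {e. e edge_of P}"

definition convex_polygon :: "nat \<Rightarrow> complex set \<Rightarrow> bool" where
  "convex_polygon n P \<longleftrightarrow> polytope P \<and> aff_dim P = 2 \<and> card (sides P) = n"

definition equilateral :: "complex set \<Rightarrow> bool" where
  "equilateral P \<longleftrightarrow> (\<exists>s. \<forall>e\<in>sides P. diameter e = s)"

definition reinhardt_inscribed :: "complex set \<Rightarrow> complex set \<Rightarrow> bool" where
  "reinhardt_inscribed P R \<longleftrightarrow>
     reuleaux_polygon R \<and> diameter R = diameter P \<and>
     vertices P \<subseteq> frontier R \<and> reuleaux_vertices R \<subseteq> vertices P"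

definition reinhardt_polygon :: "nat \<Rightarrow> complex set \<Rightarrow> bool" where
  "reinhardt_polygon n P \<longleftrightarrow>
     convex_polygon n P \<and> equilateral P \<and> (\<exists>R. reinhardt_inscribed P R)"

definition sides_opposite :: "complex set \<Rightarrow> complex set \<Rightarrow> complex \<Rightarrow> nat" where
  "sides_opposite P R v = card {e \<in> sides P. vertices e \<subseteq> opposite_arc R v}"

section \<open>Dihedral compositions and periodicity\<close>

definition dihedral_equiv :: "nat list \<Rightarrow> nat list \<Rightarrow> bool" where
  "dihedral_equiv ks ls \<longleftrightarrow> (\<exists>m. ls = rotate m ks \<or> ls = rotate m (rev ks))"

definition dihedral_composition :: "complex set \<Rightarrow> nat list set" where
  "dihedral_composition P =
     {ls. \<exists>R vs. reinhardt_inscribed P R \<and> star_traversal R vs \<and>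
                 dihedral_equiv (map (sides_opposite P R) vs) ls}"

definition periodic_polygon :: "complex set \<Rightarrow> bool" where
  "periodic_polygon P \<longleftrightarrow>
     (\<exists>d ks. d > 1 \<and> concat (replicate d ks) \<in> dihedral_composition P)"

definition sporadic_polygon :: "nat \<Rightarrow> complex set \<Rightarrow> bool" where
  "sporadic_polygon n P \<longleftrightarrow> reinhardt_polygon n P \<and> \<not> periodic_polygon P"

definition E1 :: "nat \<Rightarrow> nat" where
  "E1 n = card (dihedral_composition ` {P. sporadic_polygon n P})"

end

theory Submission
  imports Defs "HOL-Number_Theory.Cong"
begin

text \<open>
  Parametrise the boundary of the Reuleaux polygon \<open>R\<close> by its outward normal angle. Constant width
  means that antipodal boundary points differ by the width in the normal direction, so an arc
  of normals over a side of \<open>P\<close> faces an equally long interval of normals at a single vertex of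
  \<open>R\<close>. As all sides of \<open>P\<close> subtend the same angle, the circle of normals is tiled by \<open>2 * n\<close>
  intervals of length \<open>pi / n\<close>, and recording which tiles carry a side of \<open>P\<close> gives a sign sequence
  \<open>h\<close> with \<open>h (k + n) = - h k\<close> that determines the star polygon. That \<open>P\<close> closes up says that
  \<open>\<Sum>k<n. h k * z ^ k\<close> vanishes at \<open>z = cis (pi / n)\<close>, hence at every conjugate of \<open>z\<close>. For
  \<open>n = p * q\<close> every other \<open>z\<close> with \<open>z ^ n = -1\<close> satisfies \<open>z ^ p = -1\<close> or \<open>z ^ q = -1\<close>, and so
  \<open>h k + h (k + p) + h (k + q) + h (k + p + q) = 0\<close> for all \<open>k\<close>. For signs this forces
  \<open>h (k + p) = - h k\<close> for all \<open>k\<close>, or \<open>h (k + q) = - h k\<close> for all \<open>k\<close>: the polygon has a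
  rotational symmetry, and its composition repeats.
\<close>

section \<open>Galois conjugation of roots of unity\<close>

text \<open>Conjugacy of roots of unity is needed only in this form: an integer polynomial vanishing
  at \<open>z\<close> also vanishes at \<open>z ^ m\<close> for \<open>m\<close> coprime to the
  order. This is Dedekind's irreducibility argument, run directly on integer polynomials without
  naming a cyclotomic polynomial. The geometric obstacle is that vertices of \<open>R\<close> are
  defined as common points of maximal boundary arcs, whereas the argument speaks of normals. The
  bridge has two halves: such a vertex is exactly a boundary point with more than one normal, and
  the common radius of the arcs equals the width. The arc centres then are the vertices of the star
  polygon. Its segments correspond to the sign changes of \<open>h\<close> within half a turn, and
  the sides opposite to a vertex to the tiles of half a turn with that centre. Listing the vertices
  in the order of the sign changes turns a shift symmetry of \<open>h\<close> into a literally
  repeated list.\<close>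

abbreviation ieval :: "int poly \<Rightarrow> complex \<Rightarrow> complex" where
  "ieval f z \<equiv> poly (map_poly of_int f) z"

lemma ieval_pCons: "ieval (pCons a f) z = of_int a + z * ieval f z"
  by (simp add: map_poly_pCons)

lemma ieval_add: "ieval (f + g) z = ieval f z + ieval g z"
proof (induction f g rule: poly_induct2)
  case (pCons a p b q)
  then show ?case
    by (simp only: add_pCons ieval_pCons) (simp add: algebra_simps)
qed simp

lemma ieval_smult: "ieval (smult c f) z = of_int c * ieval f z"
  by (induction f) (auto simp: ieval_pCons smult_pCons algebra_simps simp del: map_poly_pCons)

lemma ieval_diff: "ieval (f - g) z = ieval f z - ieval g z"
  using ieval_add[of "f - g" g z] by simp

lemma ieval_mult: "ieval (f * g) z = ieval f z * ieval g z"
  by (induction f)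
     (simp_all add: mult_pCons_left ieval_add ieval_smult ieval_pCons algebra_simps)

lemma ieval_monom: "ieval (monom a k) z = of_int a * z ^ k"
  by (simp add: map_poly_monom poly_monom)

lemma ieval_pcompose_monom: "ieval (pcompose f (monom 1 k)) z = ieval f (z ^ k)"
  by (induction f) (simp_all add: pcompose_pCons ieval_add ieval_mult ieval_monom ieval_pCons)

section \<open>Frobenius congruences modulo a prime\<close>

lemma prime_dvd_add_power_diff:
  fixes u v :: "'a :: comm_ring_1"
  assumes "prime l"
  shows "of_nat l dvd (u + v) ^ l - (u ^ l + v ^ l)"
proof -
  have l: "l > 0" "1 < l" using assms prime_gt_0_nat prime_gt_1_nat by blast+
  have "(u + v) ^ l = (\<Sum>k\<le>l. of_nat (l choose k) * u ^ k * v ^ (l - k))"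
    by (rule binomial_ring)
  also have "{..l} = insert 0 (insert l {0<..<l})" using l by auto
  also have "(\<Sum>k\<in>\<dots>. of_nat (l choose k) * u ^ k * v ^ (l - k)) =
      v ^ l + (u ^ l + (\<Sum>k\<in>{0<..<l}. of_nat (l choose k) * u ^ k * v ^ (l - k)))"
    using l by simp
  finally have "(u + v) ^ l - (u ^ l + v ^ l) =
      (\<Sum>k\<in>{0<..<l}. of_nat (l choose k) * u ^ k * v ^ (l - k))"
    by simp
  also have "of_nat l dvd \<dots>"
  proof (rule dvd_sum)
    fix k assume "k \<in> {0<..<l}"
    then have "l dvd l choose k" using assms l by (intro dvd_choose_prime) auto
    then have "(of_nat l :: 'a) dvd of_nat (l choose k)" by (auto elim: dvdE)
    then show "of_nat l dvd of_nat (l choose k) * u ^ k * v ^ (l - k)" by simp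
  qed
  finally show ?thesis .
qed

lemma prime_dvd_power_diff_self:
  fixes a :: int
  assumes "prime l"
  shows "int l dvd a ^ l - a"
proof (induction a rule: int_induct[where k = 0])
  case base
  then show ?case using prime_gt_0_nat[OF assms] by (simp add: power_0_left)
next
  case (step1 i)
  have "(i + 1) ^ l - (i + 1) = ((i + 1) ^ l - (i ^ l + 1 ^ l)) + (i ^ l - i)" by simp
  then show ?case using step1 prime_dvd_add_power_diff[OF assms, of i 1] by (metis dvd_add)
next
  case (step2 i)
  have "(i - 1) ^ l - (i - 1) = (i ^ l - i) - ((i - 1 + 1) ^ l - ((i - 1) ^ l + 1 ^ l))" by simp
  then show ?case using step2 prime_dvd_add_power_diff[OF assms, of "i - 1" 1] by (metis dvd_diff)
qed

lemma prime_dvd_pcompose_monom_diff_power: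
  fixes f :: "int poly"
  assumes "prime l"
  shows "of_nat l dvd pcompose f (monom 1 l) - f ^ l"
proof (induction f)
  case 0
  then show ?case using prime_gt_0_nat[OF assms] by (simp add: power_0_left)
next
  case (pCons a f)
  have "[:int l:] dvd [:a - a ^ l:]"
    using prime_dvd_power_diff_self[OF assms, of a] by (simp add: dvd_diff_commute)
  then have 1: "of_nat l dvd [:a:] - [:a:] ^ l"
    by (simp add: of_nat_poly poly_const_pow)
  have x: "pCons a f = [:a:] + pCons 0 f" by simp
  have 2: "of_nat l dvd (pCons a f) ^ l - ([:a:] ^ l + (pCons 0 f) ^ l)"
    unfolding x by (rule prime_dvd_add_power_diff[OF assms])
  have m: "(pCons 0 f) ^ l = monom 1 l * f ^ l"
  proof -
    have "pCons 0 f = monom 1 1 * f" by (simp add: monom_altdef)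
    then show ?thesis by (simp only: power_mult_distrib monom_power) simp
  qed
  have 3: "of_nat l dvd monom 1 l * (pcompose f (monom 1 l) - f ^ l)"
    using pCons.IH by (rule dvd_mult)
  have "pcompose (pCons a f) (monom 1 l) - pCons a f ^ l =
      ([:a:] - [:a:] ^ l) + monom 1 l * (pcompose f (monom 1 l) - f ^ l)
      - ((pCons a f) ^ l - ([:a:] ^ l + (pCons 0 f) ^ l))"
    by (simp add: pcompose_pCons m algebra_simps)
  then show ?case using 1 2 3 by (metis dvd_add dvd_diff)
qed

text \<open>A nonzero annihilator of least degree is made primitive. Pseudo-division leaves a
  remainder of smaller degree, hence zero, and Gauss's lemma on contents cancels the factor
  \<open>a\<close> that it introduces; so divisibility holds over the integers and not just over the
  rationals.\<close>

lemma integer_minimal_poly: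
  fixes z :: complex
  assumes "g \<noteq> 0" "ieval g z = 0"
  obtains f where "f \<noteq> 0" "ieval f z = 0" "\<And>h. ieval h z = 0 \<Longrightarrow> f dvd h"
proof -
  define S where "S = {f. f \<noteq> 0 \<and> ieval f z = 0}"
  define f0 where "f0 = arg_min degree (\<lambda>f. f \<in> S)"
  have "g \<in> S" using assms by (simp add: S_def)
  then have f0: "f0 \<in> S" and min: "\<And>h. h \<in> S \<Longrightarrow> degree f0 \<le> degree h"
    unfolding f0_def by (metis arg_min_nat_lemma)+
  define f where "f = primitive_part f0"
  have f00: "f0 \<noteq> 0" "ieval f0 z = 0" using f0 by (auto simp: S_def)
  have dec: "f0 = smult (content f0) f" by (simp add: f_def)
  have fz: "f \<noteq> 0" using f00 by (simp add: f_def)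
  have cf: "content f = 1" using f00 by (simp add: f_def)
  have "of_int (content f0) * ieval f z = 0" using f00(2) dec ieval_smult by metis
  then have fev: "ieval f z = 0" using f00 by simp
  have deg: "degree f = degree f0" by (simp add: f_def)
  show thesis
  proof (rule that[OF fz fev])
    fix h assume h: "ieval h z = 0"
    obtain a q where a: "a \<noteq> 0" and aq: "smult a h = f * q + pseudo_mod h f"
      using pseudo_mod(1)[OF fz, of h] by auto
    have "of_int a * ieval h z = ieval f z * ieval q z + ieval (pseudo_mod h f) z"
      using aq by (metis ieval_add ieval_mult ieval_smult)
    then have "ieval (pseudo_mod h f) z = 0" using h fev by simp
    then have "pseudo_mod h f = 0"
      using pseudo_mod(2)[OF fz, of h] min[of "pseudo_mod h f"] deg by (fastforce simp: S_def)
    then have ah: "smult a h = f * q" using aq by simp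
    have "a dvd content (f * q)" by (simp flip: ah)
    then have "a dvd content q" by (simp add: content_mult cf)
    then have "[:a:] dvd q" by (simp add: const_poly_dvd_iff_dvd_content)
    then obtain q' where "q = smult a q'" by (auto elim!: dvdE)
    then have "smult a h = smult a (f * q')" using ah by simp
    then have "h = f * q'" using a by (metis smult_cancel)
    then show "f dvd h" by simp
  qed
qed

text \<open>
  Let \<open>x ^ N - 1 = f * g\<close> with \<open>f\<close> the minimal polynomial of \<open>z\<close>. If \<open>z ^ l\<close> is not a root of
  \<open>f\<close>, it is a root of \<open>g\<close>, so \<open>f\<close> divides \<open>g ^ l\<close> modulo \<open>l\<close>. The derivative of \<open>x ^ N - 1\<close> shows
  that \<open>N\<close> lies in the ideal \<open>(f, g)\<close>, hence \<open>N ^ l\<close> lies in \<open>(f, l)\<close>, which forces \<open>l dvd N\<close>.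
\<close>

lemma ieval_power_prime_eq_0:
  fixes z :: complex
  assumes "prime l" "\<not> l dvd N" "z ^ N = 1" "ieval h z = 0"
  shows "ieval h (z ^ l) = 0"
proof -
  have N: "N > 0" using assms(2) by (cases N) auto
  define X :: "int poly" where "X = monom 1 N - 1"
  have Xev: "ieval X w = w ^ N - 1" for w
    by (simp add: X_def ieval_diff ieval_monom)
  have "coeff X N = 1" using N by (simp add: X_def)
  then have X0: "X \<noteq> 0" by auto
  obtain f where f: "f \<noteq> 0" "ieval f z = 0" and min: "\<And>h. ieval h z = 0 \<Longrightarrow> f dvd h"
    using integer_minimal_poly[OF X0, of z] Xev assms(3) by auto
  have degf: "degree f > 0"
  proof (rule ccontr)
    assume "\<not> degree f > 0"
    then obtain c where "f = [:c:]" by (metis degree_eq_zeroE gr0I)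
    then show False using f by (simp add: map_poly_pCons)
  qed
  obtain g where g: "X = f * g" using min[of X] Xev assms(3) by (auto elim: dvdE)
  have "degree X \<le> N" by (rule degree_le) (use N in \<open>auto simp: X_def\<close>)
  moreover have "N \<le> degree X" using \<open>coeff X N = 1\<close> by (intro le_degree) simp
  ultimately have "degree X = N" by simp
  then have "lead_coeff X = 1" using \<open>coeff X N = 1\<close> by simp
  \<comment> \<open>\<open>X\<close> is monic, so its factor \<open>f\<close> has a unit as leading
    coefficient; the pseudo-division below therefore multiplies by a unit only.\<close>
  then have "lead_coeff f dvd 1" using g by (metis dvd_triv_left lead_coeff_mult)
  show ?thesis
  proof (cases "ieval f (z ^ l) = 0")
    case True
    moreover obtain k where "h = f * k" using min assms(4) by (auto elim: dvdE)
    ultimately show ?thesis by (simp add: ieval_mult)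
  next
    case False
    have "(z ^ l) ^ N = 1" using assms(3) by (metis mult.commute power_mult power_one)
    then have "ieval g (z ^ l) = 0" using False Xev[of "z ^ l"] g by (simp add: ieval_mult)
    then have "f dvd pcompose g (monom 1 l)" by (intro min) (simp add: ieval_pcompose_monom)
    moreover obtain k where k: "pcompose g (monom 1 l) - g ^ l = of_nat l * k"
      using prime_dvd_pcompose_monom_diff_power[OF assms(1), of g] by (auto elim: dvdE)
    ultimately have fg: "f dvd g ^ l + of_nat l * k" by (metis add.commute diff_add_cancel)
    define x :: "int poly" where "x = monom 1 1"
    define B where "B = x * pderiv f"
    have "x * monom (of_nat N) (N - 1) = monom (of_nat N) N"
      using N by (simp add: x_def mult_monom)
    moreover have "monom (of_nat N) N = of_nat N * monom (1::int) N"
      by (simp add: of_nat_poly smult_monom)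
    ultimately have "x * pderiv X - of_nat N * X = of_nat N"
      by (simp add: X_def pderiv_diff pderiv_monom algebra_simps)
    then have "of_nat N - g * B = f * (x * pderiv g - of_nat N * g)"
      unfolding g B_def by (simp add: pderiv_mult algebra_simps)
    then have "f dvd of_nat N - g * B" by simp
    then have "f dvd of_nat N ^ l - (g * B) ^ l"
      by (metis dvd_mult2 power_diff_sumr2)
    moreover have "f dvd (g ^ l + of_nat l * k) * B ^ l" using fg by (rule dvd_mult2)
    ultimately have "f dvd (of_nat N ^ l - (g * B) ^ l) + (g ^ l + of_nat l * k) * B ^ l"
      by (rule dvd_add)
    then have fN: "f dvd of_nat N ^ l + of_nat l * (k * B ^ l)"
      by (simp add: algebra_simps power_mult_distrib)
    \<comment> \<open>Replacing \<open>m\<close> by its remainder \<open>r\<close> leaves a multiple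
      of \<open>f\<close> of degree below \<open>degree f\<close>, hence zero. Its constant
      coefficient shows that \<open>l\<close> divides \<open>N ^ l\<close> up to a unit.\<close>
    define m where "m = k * B ^ l"
    obtain q r where qr: "pseudo_divmod m f = (q, r)" by fastforce
    define a where "a = lead_coeff f ^ (Suc (degree m) - degree f)"
    have a: "smult a m = f * q + r" and r: "r = 0 \<or> degree r < degree f"
      using pseudo_divmod[OF f(1) qr] by (auto simp: a_def)
    have a1: "a dvd 1" unfolding a_def using \<open>lead_coeff f dvd 1\<close> by (metis dvd_power_same power_one)
    have "f dvd smult a (of_nat N ^ l + of_nat l * m)"
      using fN by (simp add: m_def dvd_smult)
    also have "smult a (of_nat N ^ l + of_nat l * m) =
        f * (of_nat l * q) + (smult a (of_nat N ^ l) + of_nat l * r)"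
    proof -
      have "smult a (of_nat l * m) = of_nat l * (f * q + r)" by (metis a mult_smult_right)
      then show ?thesis by (simp add: smult_add_right algebra_simps)
    qed
    finally have dv: "f dvd smult a (of_nat N ^ l) + of_nat l * r"
      by (metis dvd_add_right_iff dvd_triv_left)
    have "degree (smult a (of_nat N ^ l) + of_nat l * r) < degree f"
    proof (rule degree_add_less)
      show "degree (smult a (of_nat N ^ l)) < degree f"
        using degf by (simp add: of_nat_poly poly_const_pow)
      show "degree (of_nat l * r) < degree f"
        using r degf by (auto simp: of_nat_poly)
    qed
    then have "smult a (of_nat N ^ l) + of_nat l * r = 0"
      using dv by (metis dvd_imp_degree_le leD)
    then have "coeff (smult a (of_nat N ^ l) + of_nat l * r) 0 = 0" by simp
    then have "a * int N ^ l + int l * coeff r 0 = 0"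
      by (simp add: of_nat_poly poly_const_pow)
    then have "int l dvd a * int N ^ l" by (metis dvd_add_times_triv_right_iff dvd_triv_left
        add.commute dvd_0_right dvd_add_right_iff)
    then have "int l dvd int N ^ l" using a1 by (metis dvd_mult_unit_iff' mult.commute)
    then have "l dvd N ^ l" by (metis of_nat_dvd_iff of_nat_power)
    then have "l dvd N" using assms(1) prime_dvd_power by blast
    then show ?thesis using assms(2) by simp
  qed
qed

text \<open>A prime factor \<open>l\<close> is stripped from \<open>m\<close> while \<open>z\<close>
  becomes \<open>z ^ l\<close>, hence the induction over arbitrary \<open>z\<close>. The value
  \<open>m = 0\<close> is coprime to \<open>N\<close> only for \<open>N = 1\<close>, where
  \<open>z = 1\<close>.\<close>

lemma ieval_power_coprime_eq_0:
  fixes z :: complex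
  assumes "coprime m N" "z ^ N = 1" "ieval h z = 0"
  shows "ieval h (z ^ m) = 0"
  using assms
proof (induction m arbitrary: z rule: less_induct)
  case (less m)
  show ?case
  proof (cases "m \<le> 1")
    case True
    then consider "m = 0" "N = 1" | "m = 1" using less.prems by (cases "m = 0") auto
    then show ?thesis using less.prems by cases auto
  next
    case False
    then obtain l where l: "prime l" "l dvd m" by (metis One_nat_def le_refl prime_factor_nat)
    then obtain m' where m: "m = l * m'" by (auto elim: dvdE)
    have "m' < m" using False l m by (metis One_nat_def less_not_refl mult_0_right n_less_m_mult_n
        nat_0_less_mult_iff not_gr_zero not_le prime_gt_1_nat zero_le)
    moreover have "coprime l N" "coprime m' N" using less.prems m by simp_all
    moreover have "\<not> l dvd N" using \<open>coprime l N\<close> l(1)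
      by (metis coprime_absorb_left not_prime_unit)
    moreover have "(z ^ l) ^ N = 1" using less.prems by (metis mult.commute power_mult power_one)
    ultimately show ?thesis
      using less.IH[of m' "z ^ l"] ieval_power_prime_eq_0[OF l(1) _ less.prems(2,3)] m
      by (simp add: power_mult)
  qed
qed

section \<open>Antiperiodic sign sequences\<close>

lemma sum_shift_periodic:
  fixes F :: "nat \<Rightarrow> 'a :: ab_group_add"
  assumes "\<And>k. F (k + n) = F k"
  shows "(\<Sum>k<n. F (k + j)) = (\<Sum>k<n. F k)"
proof (induction j)
  case (Suc j)
  have "(\<Sum>k<n. F (k + Suc j)) = (\<Sum>k<n. F (Suc k + j))" by simp
  also have "\<dots> = (\<Sum>k<Suc n. F (k + j)) - F j" by (subst sum.lessThan_Suc_shift) simp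
  also have "\<dots> = (\<Sum>k<n. F (k + j))" using assms[of j] by (simp add: add.commute)
  finally show ?case using Suc by simp
qed simp

text \<open>The odd powers of \<open>cis (pi / n)\<close> include \<open>n\<close> distinct numbers,
  too many roots for a nonzero polynomial of degree below \<open>n\<close>.\<close>

lemma antiperiodic_sum_zero_imp_zero:
  fixes D :: "nat \<Rightarrow> complex"
  assumes n: "n > 0" and D: "\<And>m. odd m \<Longrightarrow> (\<Sum>k<n. D k * (cis (pi / n) ^ m) ^ k) = 0"
  shows "k < n \<Longrightarrow> D k = 0"
proof -
  define P where "P = (\<Sum>k<n. monom (D k) k)"
  have cf: "coeff P k = (if k < n then D k else 0)" for k
    by (simp add: P_def coeff_sum)
  have ev: "poly P w = (\<Sum>k<n. D k * w ^ k)" for w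
    by (simp add: P_def poly_sum poly_monom)
  let ?r = "\<lambda>j. cis (pi / n) ^ (2 * j + 1)"
  have inj: "inj_on ?r {..<n}"
  proof (rule inj_onI)
    fix i j assume ij: "i \<in> {..<n}" "j \<in> {..<n}" "?r i = ?r j"
    have r: "?r i = cis (pi / n) * cis (2 * pi * i / n)" for i
      by (simp add: Complex.DeMoivre cis_mult field_simps)
    have "cis (2 * pi * i / n) = cis (2 * pi * j / n)" using ij(3) unfolding r by simp
    moreover have "inj_on (\<lambda>k. cis (2 * pi * real k / real n)) {..<n}"
      using Complex.bij_betw_roots_unity[OF n] by (simp add: bij_betw_def)
    ultimately show "i = j" using ij(1,2) by (simp add: inj_on_def)
  qed
  have "P = 0"
  proof (rule ccontr)
    assume P: "P \<noteq> 0"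
    have "?r ` {..<n} \<subseteq> {w. poly P w = 0}"
      using D by (auto simp: ev simp del: power_Suc power_Suc2 power_add)
    then have "n \<le> card {w. poly P w = 0}"
      using inj P by (metis card_image card_lessThan card_mono poly_roots_finite)
    also have "\<dots> \<le> degree P" using P by (rule card_poly_roots_bound)
    finally have "coeff P (degree P) = 0" by (simp add: cf)
    then show False using P by simp
  qed
  then show "k < n \<Longrightarrow> D k = 0" using cf[of k] by simp
qed

lemma antiperiodic_sign_four_term:
  fixes h :: "nat \<Rightarrow> int" and p q n :: nat
  assumes pq: "prime p" "prime q" "odd p" "odd q" "n = p * q"
    and h: "\<And>k. h (k + n) = - h k"
    and sum0: "(\<Sum>k<n. of_int (h k) * cis (pi / n) ^ k) = 0"
  shows "h k + h (k + p) + h (k + q) + h (k + p + q) = 0"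
proof -
  have p0: "p > 0" "q > 0" using pq prime_gt_0_nat by blast+
  then have n: "n > 0" using pq by simp
  define z where "z = cis (pi / n)"
  have zn: "z ^ n = -1" using n by (simp add: z_def Complex.DeMoivre)
  define D where "D k = h k + h (k + p) + h (k + q) + h (k + p + q)" for k
  define H where "H = (\<Sum>k<n. monom (h k) k)"
  have Hev: "ieval H w = (\<Sum>k<n. of_int (h k) * w ^ k)" for w
  proof -
    have "ieval (\<Sum>k\<in>A. monom (h k) k) w = (\<Sum>k\<in>A. of_int (h k) * w ^ k)" if "finite A" for A
      using that by induction (simp_all add: ieval_add ieval_monom)
    then show ?thesis by (simp add: H_def)
  qed
  have "(\<Sum>k<n. of_int (D k) * (cis (pi / n) ^ m) ^ k) = 0" if "odd m" for m
  proof -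
    define w where "w = z ^ m"
    have w0: "w \<noteq> 0" by (simp add: w_def z_def)
    have wn: "w ^ n = -1"
      using zn that by (simp add: w_def power_mult[symmetric] mult.commute[of m])
         (simp add: power_mult)
    define S where "S = ieval H w"
    \<comment> \<open>The sign changes of \<open>h (k + n)\<close> and \<open>w ^ (k + n)\<close>
      cancel, so the terms \<open>h k * w ^ k\<close> have period \<open>n\<close>.\<close>
    have shift: "w ^ j * (\<Sum>k<n. of_int (h (k + j)) * w ^ k) = S" for j
    proof -
      have "w ^ j * (\<Sum>k<n. of_int (h (k + j)) * w ^ k) = (\<Sum>k<n. of_int (h (k + j)) * w ^ (k + j))"
        by (simp add: sum_distrib_left power_add algebra_simps)
      also have "\<dots> = (\<Sum>k<n. of_int (h k) * w ^ k)"
        by (rule sum_shift_periodic) (simp add: h power_add wn)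
      finally show ?thesis by (simp add: S_def Hev)
    qed
    \<comment> \<open>Multiplying by \<open>w ^ (p + q)\<close> avoids negative exponents; the four
      shifts then collect into the factors \<open>1 + w ^ p\<close> and
      \<open>1 + w ^ q\<close>.\<close>
    have "w ^ (p + q) * (\<Sum>k<n. of_int (D k) * w ^ k) =
      w ^ (p + q) * (w ^ 0 * (\<Sum>k<n. of_int (h (k + 0)) * w ^ k))
      + w ^ q * (w ^ p * (\<Sum>k<n. of_int (h (k + p)) * w ^ k))
      + w ^ p * (w ^ q * (\<Sum>k<n. of_int (h (k + q)) * w ^ k))
      + w ^ (p + q) * (\<Sum>k<n. of_int (h (k + (p + q))) * w ^ k)"
      by (simp add: D_def algebra_simps sum.distrib power_add)
    also have "\<dots> = S * (1 + w ^ p) * (1 + w ^ q)"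
      unfolding shift by (simp add: algebra_simps power_add)
    also have "\<dots> = 0"
    proof (cases "coprime m (2 * n)")
      case True
      have "z ^ (2 * n) = 1" using zn by (simp add: power_mult mult.commute[of 2])
      moreover have "ieval H z = 0" using sum0 by (simp add: Hev z_def)
      ultimately have "S = 0" using ieval_power_coprime_eq_0[OF True] by (simp add: S_def w_def)
      then show ?thesis by simp
    next
      case False
      then have "p dvd m \<or> q dvd m" using that pq
        by (metis coprime_commute coprime_mult_left_iff coprime_right_2_iff_odd prime_imp_coprime_nat)
      then show ?thesis
      proof
        assume "p dvd m"
        then obtain i where i: "m = p * i" by (auto elim: dvdE)
        \<comment> \<open>The exponent \<open>i\<close> is odd because \<open>m\<close> is, so the
          power is \<open>-1\<close>.\<close>
        then have "w ^ q = (z ^ n) ^ i"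
          by (simp add: w_def pq(5) power_mult[symmetric] algebra_simps)
        then have "w ^ q = -1" using zn i that by simp
        then show ?thesis by simp
      next
        assume "q dvd m"
        then obtain i where i: "m = q * i" by (auto elim: dvdE)
        then have "w ^ p = (z ^ n) ^ i"
          by (simp add: w_def pq(5) power_mult[symmetric] algebra_simps)
        then have "w ^ p = -1" using zn i that by simp
        then show ?thesis by simp
      qed
    qed
    finally show ?thesis using w0 by (simp add: w_def z_def)
  qed
  then have "of_int (D k) = (0::complex)" if "k < n" for k
    using antiperiodic_sum_zero_imp_zero[OF n, of "\<lambda>k. of_int (D k)" k] that by blast
  then have small: "D k = 0" if "k < n" for k using that by simp
  have anti: "D (k + n) = - D k" for k
    using h[of k] h[of "k + p"] h[of "k + q"] h[of "k + p + q"] by (simp add: D_def algebra_simps)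
  have "D k = 0"
  proof (induction k rule: less_induct)
    case (less k)
    then show ?case using small[of k] anti[of "k - n"] n by (cases "k < n") auto
  qed
  then show ?thesis by (simp add: D_def)
qed

text \<open>Suppose the first alternative fails at \<open>x\<close> and the second at
  \<open>y\<close>. Four signs with sum zero split evenly, so \<open>h (k + p) = h k\<close>
  propagates from \<open>x\<close> in steps of \<open>q\<close>, while
  \<open>h (k + q) = h k\<close>, and with it \<open>h (k + p) = - h k\<close>, propagates from
  \<open>y\<close> in steps of \<open>p\<close>. The Chinese remainder theorem gives a point
  \<open>u\<close> on both progressions.\<close>

lemma antiperiodic_sign_dichotomy:
  fixes h :: "nat \<Rightarrow> int" and p q n :: nat
  assumes pq: "prime p" "prime q" "odd p" "odd q" "p \<noteq> q" "n = p * q"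
    and h: "\<And>k. h (k + n) = - h k" and sgn: "\<And>k. h k = 1 \<or> h k = -1"
    and sum0: "(\<Sum>k<n. of_int (h k) * cis (pi / n) ^ k) = 0"
  shows "(\<forall>k. h (k + p) = - h k) \<or> (\<forall>k. h (k + q) = - h k)"
proof (rule ccontr)
  assume "\<not> ?thesis"
  then obtain x y where "h (x + p) \<noteq> - h x" "h (y + q) \<noteq> - h y" by blast
  then have x: "h (x + p) = h x" and y: "h (y + q) = h y" using sgn by (metis minus_minus)+
  have four: "h k + h (k + p) + h (k + q) + h (k + p + q) = 0" for k
    using antiperiodic_sign_four_term[OF pq(1-4,6) h sum0] .
  have A: "h (x + j * q + p) = h (x + j * q)" for j
  proof (induction j)
    case (Suc j)
    then show ?case
      using four[of "x + j * q"] sgn[of "x + j * q"] sgn[of "x + j * q + q"] sgn[of "x + j * q + p + q"]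
      by (auto simp: algebra_simps)
  qed (simp add: x)
  have B: "h (y + i * p + q) = h (y + i * p) \<and> h (y + i * p + p) = - h (y + i * p)" for i
  proof (induction i)
    case 0
    then show ?case using four[of y] sgn[of y] sgn[of "y + p"] sgn[of "y + p + q"] y by auto
  next
    case (Suc i)
    have s: "y + Suc i * p = y + i * p + p" by simp
    have "h (y + i * p + p + q) = h (y + i * p + p)"
      using four[of "y + i * p"] sgn[of "y + i * p"] sgn[of "y + i * p + p"] sgn[of "y + i * p + p + q"] Suc
      by auto
    then show ?case unfolding s
      using four[of "y + i * p + p"] sgn[of "y + i * p + p"] sgn[of "y + i * p + p + p"]
        sgn[of "y + i * p + p + p + q"] by auto
  qed
  have "coprime p q" using pq by (simp add: primes_coprime)
  then obtain v where v: "[v = y] (mod p)" "[v = x] (mod q)"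
    using binary_chinese_remainder_nat by blast
  \<comment> \<open>The added multiple of \<open>p * q\<close> preserves both congruences and lifts
    \<open>u\<close> above \<open>x\<close> and \<open>y\<close>, so that \<open>i\<close> and
    \<open>j\<close> are natural numbers.\<close>
  define u where "u = v + p * q * (x + y)"
  have pos: "p * q \<ge> 1" using pq prime_gt_0_nat by (metis One_nat_def Suc_leI nat_0_less_mult_iff)
  have ge: "u \<ge> x" "u \<ge> y" using pos unfolding u_def
    by (metis add_leD1 add_leD2 add.commute le_add2 mult_le_mono1 nat_mult_1 order_trans)+
  have "u = v + p * (q * (x + y))" "u = v + q * (p * (x + y))" by (simp_all add: u_def)
  then have "[u = y] (mod p)" "[u = x] (mod q)"
    using v by (metis cong_def mod_mult_self2)+
  then obtain i j where "u = y + i * p" "u = x + j * q"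
    using ge by (metis cong_altdef_nat cong_sym dvdE le_add_diff_inverse mult.commute cong_le_nat)
  then show False using A[of j] B[of i] sgn[of u] by auto
qed

section \<open>Support curves of Reuleaux polygons\<close>

lemma cis_2pi_int: "cis (2 * pi * of_int k) = 1"
  by (simp add: complex_eq_iff cos_int_2pin sin_int_2pin)

lemma cis_2pi_nat: "cis (2 * pi * real k) = 1"
  using cis_2pi_int[of "int k"] by simp

lemma cis_eq_imp_int:
  assumes "cis s = cis t"
  obtains k :: int where "s = t + 2 * pi * of_int k"
proof -
  have "cis (s - t) = 1" using assms by (simp flip: cis_divide)
  then have "cos (s - t) = 1" by (simp add: complex_eq_iff)
  then obtain k :: int where "s - t = of_int k * 2 * pi" by (auto simp: cos_one_2pi_int)
  then show thesis using that[of k] by (simp add: algebra_simps)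
qed

lemma cis_eq_imp_eq:
  assumes "cis s = cis t" "\<bar>s - t\<bar> < 2 * pi"
  shows "s = t"
proof -
  obtain k :: int where k: "s = t + 2 * pi * of_int k" using cis_eq_imp_int[OF assms(1)] .
  then have "2 * pi * \<bar>of_int k\<bar> < 2 * pi * 1" using assms(2) by (simp add: abs_mult)
  then have "\<bar>real_of_int k\<bar> < 1" using mult_less_cancel_left_pos[of "2 * pi"] pi_gt_zero by simp
  then have "k = 0" by linarith
  then show ?thesis using k by simp
qed

lemma constant_on_Icc_of_finite_range:
  fixes f :: "real \<Rightarrow> complex"
  assumes "continuous_on UNIV f" "s < t" "finite F" "\<And>u. s < u \<Longrightarrow> u < t \<Longrightarrow> f u \<in> F"
    and u: "s \<le> u" "u \<le> t"
  shows "f u = f s"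
proof -
  have "f ` {s<..<t} \<subseteq> F" using assms(4) by auto
  then have "f constant_on {s<..<t}"
    using finite_subset[OF _ assms(3)] continuous_on_subset[OF assms(1)]
    by (intro continuous_finite_range_constant) auto
  then obtain c where c: "\<And>u. u \<in> {s<..<t} \<Longrightarrow> f u = c" by (auto simp: constant_on_def)
  have "continuous_on (closure {s<..<t}) f" using continuous_on_subset[OF assms(1)] by blast
  then have "f v = c" if "v \<in> closure {s<..<t}" for v
    using continuous_constant_on_closure c that by blast
  then show ?thesis using u assms(2) by simp
qed

text \<open>
  Here \<open>x t\<close> is the point at which the outward unit normal is \<open>cis t\<close>, \<open>RV\<close> and \<open>V\<close> are the
  vertices of the Reuleaux polygon and of the inscribed polygon, and \<open>a\<close> is the angle
  subtended by a side of the latter.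
\<close>

locale reuleaux_curve =
  fixes x :: "real \<Rightarrow> complex" and w :: real and RV V :: "complex set" and a :: real
  assumes w_pos: "w > 0"
    and antip: "x (t + pi) = x t - of_real w * cis t"
    and cont: "continuous_on UNIV x"
    and corner_const: "\<lbrakk>x s = x t; s < t; t < s + pi; s \<le> u; u \<le> t\<rbrakk> \<Longrightarrow> x u = x s"
    and RV_eq: "RV = {x s | s t. s < t \<and> t < s + pi \<and> x s = x t}"
    and finV: "finite V" and RV_V: "RV \<subseteq> V"
    and cover: "x t \<in> RV \<or> x (t + pi) \<in> RV"
    and gap: "\<lbrakk>s < t; x s \<in> V; x t \<in> V; \<And>u. s < u \<Longrightarrow> u < t \<Longrightarrow> x u \<notin> V\<rbrakk> \<Longrightarrow> t - s = a"
begin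

section \<open>Tiling the circle of normals\<close>

lemma periodic: "x (t + 2 * pi) = x t"
proof -
  have "x (t + 2 * pi) = x (t + pi + pi)" by (simp add: algebra_simps)
  also have "\<dots> = x t" unfolding antip by (simp add: cis_mult[symmetric])
  finally show ?thesis .
qed

lemma periodic_nat: "x (t + 2 * pi * real k) = x t"
proof (induction k)
  case (Suc k)
  then show ?case using periodic[of "t + 2 * pi * real k"] by (simp add: algebra_simps)
qed simp

lemma antipodal_neq: "x (t + pi) \<noteq> x t"
  using w_pos by (simp add: antip)

lemma finite_range_const:
  assumes "s < t" "finite F" "\<And>u. s < u \<Longrightarrow> u < t \<Longrightarrow> x (u + d) \<in> F" "s \<le> u" "u \<le> t"
  shows "x (u + d) = x (s + d)"
proof (rule constant_on_Icc_of_finite_range[OF _ assms])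
  show "continuous_on UNIV (\<lambda>u. x (u + d))"
    by (intro continuous_intros continuous_on_compose2[OF cont]) auto
qed

text \<open>The ends of tiles. Asking for both antipodal points makes the notion invariant under
  adding \<open>pi\<close>, so sides seen in opposite directions cut the circle at common
  points.\<close>

definition node :: "real \<Rightarrow> bool" where
  "node t \<longleftrightarrow> x t \<in> V \<and> x (t + pi) \<in> V"

text \<open>The second conjunct fixes the point facing the tile; it is the centre of the circular
  arc that \<open>x\<close> sweeps there.\<close>

definition arc :: "real \<Rightarrow> bool" where
  "arc t \<longleftrightarrow> (\<forall>u. t < u \<and> u < t + a \<longrightarrow> x u \<notin> V) \<and>
     (\<forall>u. t \<le> u \<and> u \<le> t + a \<longrightarrow> x (u + pi) = x (t + pi))"

lemma arcD1: "arc t \<Longrightarrow> t < u \<Longrightarrow> u < t + a \<Longrightarrow> x u \<notin> V"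
  unfolding arc_def by blast

lemma arcD2: "arc t \<Longrightarrow> t \<le> u \<Longrightarrow> u \<le> t + a \<Longrightarrow> x (u + pi) = x (t + pi)"
  unfolding arc_def by blast

text \<open>By \<open>cover\<close> the points opposite to \<open>u\<close> are vertices, so the
  nearest normals on either side with value in \<open>V\<close> exist within distance
  \<open>pi\<close>. Between them every opposite point lies in the finite set \<open>RV\<close>; by
  continuity it does not move, and both ends are nodes.\<close>

lemma gap_exists:
  assumes u: "x u \<notin> V"
  obtains s where "s < u" "u < s + a" "arc s" "node s" "node (s + a)"
proof -
  have V1: "x (u + pi) \<in> V" using cover[of u] u RV_V by auto
  then have V2: "x (u - pi) \<in> V" using periodic[of "u - pi"]
    by (simp add: add.commute[of u pi])
  have clV: "closed (x -` V)"
    by (rule closed_vimage[OF finite_imp_closed[OF finV] cont])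
  define L where "L = (x -` V) \<inter> {u - pi..u}"
  define U where "U = (x -` V) \<inter> {u..u + pi}"
  have "closed L" "closed U" using clV by (auto simp: L_def U_def)
  moreover have "u - pi \<in> L" "u + pi \<in> U" using V1 V2 by (simp_all add: L_def U_def)
  moreover have bL: "bdd_above L" unfolding L_def by (intro bdd_above_Int2) simp
  moreover have bU: "bdd_below U" unfolding U_def by (intro bdd_below_Int2) simp
  ultimately have "Sup L \<in> L" "Inf U \<in> U"
    by (metis closed_contains_Sup empty_iff, metis closed_contains_Inf empty_iff)
  define s where "s = Sup L"
  define t where "t = Inf U"
  have sL: "s \<in> L" and tU: "t \<in> U"
    using \<open>Sup L \<in> L\<close> \<open>Inf U \<in> U\<close> by (simp_all add: s_def t_def)
  then have s: "x s \<in> V" "s \<le> u" and t: "x t \<in> V" "u \<le> t" by (auto simp: L_def U_def)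
  then have "s \<noteq> u" "t \<noteq> u" using u by metis+
  then have s: "x s \<in> V" "s < u" and t: "x t \<in> V" "u < t" using s t by simp_all
  have btw: "x v \<notin> V" if "s < v" "v < t" for v
  proof
    assume v: "x v \<in> V"
    show False
    proof (cases "v \<le> u")
      case True
      have "u - pi \<le> s" using sL by (simp add: L_def)
      then have "v \<in> L" using True v that by (auto simp: L_def)
      then have "v \<le> s" using cSup_upper[OF _ bL] by (simp add: s_def)
      then show False using that by simp
    next
      case False
      have "t \<le> u + pi" using tU by (simp add: U_def)
      then have "v \<in> U" using False v that by (auto simp: U_def)
      then have "t \<le> v" using cInf_lower[OF _ bU] by (simp add: t_def)
      then show False using that by simp
    qed
  qed
  have st: "s < t" using s t by simp
  have tsa: "t - s = a" using gap[OF st s(1) t(1) btw] .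
  have inRV: "x (v + pi) \<in> RV" if "s < v" "v < t" for v
    using cover[of v] btw[OF that] RV_V by auto
  have con: "x (v + pi) = x (s + pi)" if "s \<le> v" "v \<le> t" for v
    using finite_range_const[OF st finite_subset[OF RV_V finV] inRV that] .
  have "x (s + pi) \<in> V" "x (t + pi) \<in> V"
    using con[of u] con[of t] inRV[of u] s(2) t(2) RV_V by (metis less_eq_real_def less_trans subsetD)+
  then have "node s" "node t" using s t by (auto simp: node_def)
  moreover have "s + a = t" using tsa by simp
  then have "arc s" unfolding arc_def \<open>s + a = t\<close> using btw con by blast
  ultimately show thesis using that[of s] s(2) t(2) tsa by (metis add.commute diff_add_cancel)
qed

lemma node_antipodal: "node (t + pi) = node t"
  using periodic[of t] by (auto simp: node_def algebra_simps)

text \<open>If both antipodal points stayed in the finite set \<open>V\<close>, both would be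
  constant, and so would their difference \<open>of_real w * cis t\<close>.\<close>

lemma dense: "s < t \<Longrightarrow> \<exists>u. s < u \<and> u < t \<and> (x u \<notin> V \<or> x (u + pi) \<notin> V)"
proof (rule ccontr)
  assume st: "s < t" and "\<not> ?thesis"
  then have *: "x (u + 0) \<in> V" "x (u + pi) \<in> V" if "s < u" "u < t" for u using that by auto
  \<comment> \<open>The cap \<open>s + 1\<close> keeps the interval below a full turn, where
    \<open>cis\<close> is injective.\<close>
  define v where "v = min t (s + 1)"
  have v: "s < v" "v \<le> t" "v < s + 2 * pi" using st pi_gt3 by (auto simp: v_def)
  have "s \<le> v" using v by simp
  have 1: "x (v + 0) = x (s + 0)" using finite_range_const[OF st finV *(1) \<open>s \<le> v\<close> v(2)] .
  have 2: "x (v + pi) = x (s + pi)" using finite_range_const[OF st finV *(2) \<open>s \<le> v\<close> v(2)] .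
  have "of_real w * cis v = of_real w * cis s" using 1 2 unfolding antip by simp
  then have "cis v = cis s" using w_pos by simp
  moreover have "\<bar>v - s\<bar> < 2 * pi" using v by linarith
  ultimately have "v = s" by (rule cis_eq_imp_eq)
  then show False using v by simp
qed


lemma a_bounds: "0 < a" "a < pi"
proof -
  obtain u where "x u \<notin> V" using dense[of 0 1] by auto
  then obtain s where s: "s < u" "u < s + a" "arc s" by (rule gap_exists)
  show "0 < a" using s by linarith
  show "a < pi"
  proof (rule ccontr)
    assume "\<not> a < pi"
    then have "x (s + pi + pi) = x (s + pi)" by (intro arcD2[OF s(3)]) simp_all
    then show False using antipodal_neq by blast
  qed
qed

lemma tile_exists:
  assumes "\<not> node u"
  obtains s where "s < u" "u < s + a" "node s" "node (s + a)" "arc s \<or> arc (s + pi)"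
proof (cases "x u \<in> V")
  case False
  then obtain s where "s < u" "u < s + a" "arc s" "node s" "node (s + a)" by (rule gap_exists)
  then show thesis using that by blast
next
  case True
  then have "x (u + pi) \<notin> V" using assms by (simp add: node_def)
  then obtain s where s: "s < u + pi" "u + pi < s + a" "arc s" "node s" "node (s + a)"
    by (rule gap_exists)
  have "node (s - pi)" using node_antipodal[of "s - pi"] s(4) by simp
  moreover have "node (s - pi + a)" using node_antipodal[of "s - pi + a"] s(5) by simp
  moreover have "arc (s - pi + pi)" using s(3) by simp
  ultimately show thesis using that[of "s - pi"] s(1,2) by simp
qed

lemma tile_no_node:
  assumes "arc s \<or> arc (s + pi)" "s < v" "v < s + a"
  shows "\<not> node v"
  using assms(1)
proof
  assume "arc s"
  then show ?thesis using arcD1[of s v] assms by (simp add: node_def)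
next
  assume "arc (s + pi)"
  then show ?thesis using arcD1[of "s + pi" "v + pi"] assms by (simp add: node_def)
qed

text \<open>Tiles contain no nodes, and non-nodes are dense. The tile of a non-node between
  \<open>t\<close> and \<open>t + a\<close> starts at some \<open>s >= t\<close>; if
  \<open>s > t\<close>, another tile of length \<open>a\<close> would have to fit between
  \<open>t\<close> and \<open>s\<close>, although \<open>s < t + a\<close>.\<close>

lemma node_step:
  assumes "node t"
  shows "node (t + a)" "arc t \<or> arc (t + pi)"
proof -
  have nonnode: "\<exists>u. r < u \<and> u < r' \<and> \<not> node u" if "r < r'" for r r'
    using dense[OF that] unfolding node_def by blast
  obtain u where u: "t < u" "u < t + a" "\<not> node u" using nonnode[of t "t + a"] a_bounds by auto
  obtain s where s: "s < u" "u < s + a" "node (s + a)" "node s" "arc s \<or> arc (s + pi)"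
    using tile_exists[OF u(3)] by metis
  have ts: "t \<le> s" using tile_no_node[OF s(5), of t] assms u s by linarith
  have "t = s"
  proof (rule ccontr)
    assume "t \<noteq> s"
    then obtain v where v: "t < v" "v < s" "\<not> node v" using nonnode[of t s] ts by auto
    obtain r where r: "r < v" "v < r + a" "arc r \<or> arc (r + pi)"
      using tile_exists[OF v(3)] by metis
    have "t \<le> r" using tile_no_node[OF r(3), of t] assms v r by linarith
    moreover have "r + a \<le> s" using tile_no_node[OF r(3), of s] s(4) v r by linarith
    ultimately show False using u s by linarith
  qed
  then show "node (t + a)" "arc t \<or> arc (t + pi)" using s by simp_all
qed

text \<open>In the middle of the tile, \<open>arc t\<close> puts the opposite point at the vertex
  \<open>x (t + pi)\<close>, while \<open>arc (t + pi)\<close> keeps it out of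
  \<open>V\<close>.\<close>

lemma node_arc_exclusive:
  assumes "node t"
  shows "arc (t + pi) \<longleftrightarrow> \<not> arc t"
proof -
  have "\<not> (arc t \<and> arc (t + pi))"
  proof
    assume "arc t \<and> arc (t + pi)"
    then have "x (t + a / 2 + pi) = x (t + pi)" "x (t + a / 2 + pi) \<notin> V"
      using arcD2[of t "t + a / 2"] arcD1[of "t + pi" "t + a / 2 + pi"] a_bounds by simp_all
    then show False using assms by (simp add: node_def)
  qed
  then show ?thesis using node_step(2)[OF assms] by blast
qed

text \<open>
  The angles \<open>T k\<close> cut the circle of normal directions into tiles of length \<open>a\<close>. Tile \<open>k\<close> is
  either swept by one side of the polygon (\<open>h k = 1\<close>), and \<open>c k\<close> is the centre of the arc over
  that side, or it consists of normals at the single point \<open>c k\<close> (\<open>h k = -1\<close>).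
\<close>

definition t0 :: real where "t0 = (SOME t. node t)"

definition T :: "nat \<Rightarrow> real" where "T k = t0 + real k * a"

definition N :: nat where "N = nat \<lfloor>pi / a\<rfloor>"

definition h :: "nat \<Rightarrow> int" where "h k = (if arc (T k) then 1 else -1)"

definition c :: "nat \<Rightarrow> complex" where "c k = (if arc (T k) then x (T k + pi) else x (T k))"

lemma node_t0: "node t0"
proof -
  obtain u where "x u \<notin> V" using dense[of 0 1] by auto
  then obtain s where "node s" by (rule gap_exists)
  then show ?thesis unfolding t0_def by (rule someI)
qed

lemma T_0: "T 0 = t0" by (simp add: T_def)

lemma T_Suc: "T (Suc k) = T k + a" by (simp add: T_def algebra_simps)

lemma T_add: "T (k + j) = T k + real j * a" by (simp add: T_def algebra_simps)

lemma node_T: "node (T k)"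
  by (induction k) (simp_all add: T_0 T_Suc node_t0 node_step(1))

lemma tile_cover:
  assumes "t0 \<le> u"
  obtains k where "T k \<le> u" "u < T (Suc k)"
proof -
  define k where "k = nat \<lfloor>(u - t0) / a\<rfloor>"
  have "0 \<le> (u - t0) / a" using assms a_bounds by simp
  then have "real k \<le> (u - t0) / a" "(u - t0) / a < real k + 1"
    by (simp_all add: k_def)
  then have "T k \<le> u" "u < T (Suc k)" using a_bounds by (simp_all add: T_def field_simps)
  then show thesis by (rule that)
qed

lemma T_tile: "arc (T k) \<or> arc (T k + pi)"
  using node_step(2)[OF node_T] .

lemma node_imp_T:
  assumes "node u" "t0 \<le> u"
  obtains k where "u = T k"
proof -
  obtain k where k: "T k \<le> u" "u < T (Suc k)" using tile_cover[OF assms(2)] .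
  have "\<not> T k < u" using tile_no_node[OF T_tile, of k u] assms(1) k(2) by (auto simp: T_Suc)
  then show thesis using that[of k] k(1) by simp
qed

text \<open>\<open>t0\<close> and \<open>t0 + pi\<close> are both nodes, so a whole number of tiles
  fills half a turn and the floor in \<open>N\<close> is exact.\<close>

lemma N_a: "real N * a = pi"
proof -
  have "node (t0 + pi)" using node_t0 by (simp add: node_antipodal)
  then obtain k where "t0 + pi = T k" using pi_gt_zero by (auto elim: node_imp_T)
  then have "real k * a = pi" by (simp add: T_def)
  moreover have "N = k" using calculation a_bounds by (simp add: N_def flip: calculation)
  ultimately show ?thesis by simp
qed

lemma T_N: "T (k + N) = T k + pi"
  by (simp add: T_add N_a)

lemma T_2N: "T (k + 2 * N) = T k + 2 * pi"
  using N_a by (simp add: T_add algebra_simps)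

lemma N_gt_1: "N > 1"
proof (rule ccontr)
  assume "\<not> N > 1"
  then have "real N * a \<le> 1 * a" using a_bounds by (intro mult_right_mono) auto
  then show False using N_a a_bounds by simp
qed

lemma h_sign: "h k = 1 \<or> h k = -1"
  by (simp add: h_def)

lemma h_antiperiodic: "h (k + N) = - h k"
  using node_arc_exclusive[OF node_T[of k]] by (simp add: h_def T_N)

lemma c_periodic: "c (k + N) = c k"
  using node_arc_exclusive[OF node_T[of k]] periodic[of "T k"]
  by (auto simp: c_def T_N algebra_simps)

lemma arc_center:
  assumes "h k = 1" "T k \<le> u" "u \<le> T (Suc k)"
  shows "x (u + pi) = c k"
proof -
  have "arc (T k)" using assms(1) by (simp add: h_def split: if_splits)
  then show ?thesis using arcD2[of "T k" u] assms by (simp add: c_def T_Suc)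
qed

lemma corner_center:
  assumes "h k = -1" "T k \<le> u" "u \<le> T (Suc k)"
  shows "x u = c k"
proof -
  have n: "\<not> arc (T k)" using assms(1) by (simp add: h_def split: if_splits)
  then have "arc (T k + pi)" using T_tile by blast
  then have "x (u + pi + pi) = x (T k + pi + pi)"
    using arcD2[of "T k + pi" "u + pi"] assms by (simp add: T_Suc)
  then have "x u = x (T k)"
    using periodic[of u] periodic[of "T k"] by (simp add: add.assoc flip: mult_2)
  then show ?thesis using n by (simp add: c_def)
qed

text \<open>Equal signs keep the centre; at a sign change it passes from one of the antipodal points
  with normals \<open>T (Suc k)\<close> and \<open>T (Suc k) + pi\<close> to the other. The
  coefficient is the signed indicator of such a change.\<close>

lemma center_step:
  "c (Suc k) - c k = of_real ((real_of_int (h k) - h (Suc k)) / 2) * (of_real w * cis (T (Suc k)))"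
proof -
  have T: "T k \<le> T (Suc k)" "T (Suc k) \<le> T (Suc (Suc k))" using a_bounds by (simp_all add: T_Suc)
  note * = arc_center[of k "T (Suc k)"] arc_center[of "Suc k" "T (Suc k)"]
    corner_center[of k "T (Suc k)"] corner_center[of "Suc k" "T (Suc k)"]
  show ?thesis
    using h_sign[of k] h_sign[of "Suc k"] T
    by (elim disjE) (simp_all add: *[symmetric] antip)
qed

text \<open>The centres close up after \<open>N\<close> tiles, so their steps sum to zero. Summation
  by parts, with the signs of \<open>h (k + N)\<close> and \<open>z ^ N\<close> cancelling, turns
  this into \<open>(z - 1) * S = 0\<close>.\<close>

lemma sign_sum_zero: "(\<Sum>k<N. of_int (h k) * cis (pi / N) ^ k) = 0"
proof -
  define z where "z = cis (pi / N)"
  have "real N \<noteq> 0" using N_gt_1 by linarith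
  then have "pi / N = a" by (metis N_a nonzero_mult_div_cancel_left)
  then have "z ^ k = cis (real k * a)" for k by (simp add: z_def Complex.DeMoivre)
  then have cT: "cis (T k) = cis t0 * z ^ k" for k by (simp add: T_def cis_mult)
  have zN: "z ^ N = -1" using N_gt_1 by (simp add: z_def Complex.DeMoivre)
  define S where "S = (\<Sum>k<N. of_int (h k) * z ^ k)"
  have "(\<Sum>k<N. c (Suc k) - c k) = 0"
    using c_periodic[of 0] by (simp add: sum_lessThan_telescope)
  moreover have "c (Suc k) - c k =
      (of_real w * cis t0 / 2) * (of_int (h k) * z ^ Suc k - of_int (h (Suc k)) * z ^ Suc k)" for k
    unfolding center_step cT by (simp add: algebra_simps diff_divide_distrib)
  ultimately have "(of_real w * cis t0 / 2) *
      (\<Sum>k<N. of_int (h k) * z ^ Suc k - of_int (h (Suc k)) * z ^ Suc k) = 0"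
    by (simp only: sum_distrib_left)
  then have 0: "(\<Sum>k<N. of_int (h k) * z ^ Suc k - of_int (h (Suc k)) * z ^ Suc k) = 0"
    using w_pos by simp
  have "(\<Sum>k<N. of_int (h (k + 1)) * z ^ (k + 1)) = S"
    unfolding S_def
  proof (rule sum_shift_periodic)
    show "of_int (h (k + N)) * z ^ (k + N) = of_int (h k) * z ^ k" for k
      by (simp add: h_antiperiodic power_add zN)
  qed
  moreover have "(\<Sum>k<N. of_int (h k) * z ^ Suc k) = z * S"
    by (simp add: S_def sum_distrib_left algebra_simps)
  ultimately have "(z - 1) * S = 0"
    using 0 by (simp add: sum_subtractf algebra_simps)
  moreover have "z \<noteq> 1"
  proof
    assume "z = 1"
    then show False using zN by simp
  qed
  ultimately show ?thesis by (simp add: S_def z_def)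
qed

text \<open>A stretch of normals at one vertex cannot overlap an arc tile in an interval: just after
  \<open>r\<close> the point would be in \<open>V\<close> and, being inside the tile, outside
  \<open>V\<close>.\<close>

lemma not_const_arc:
  assumes "h k = 1" "s < t" "t < s + pi" "x s = x t" "x s \<in> V" "s \<le> r" "r < t" "T k \<le> r" "r < T (Suc k)"
  shows False
proof -
  define u where "u = (r + min t (T (Suc k))) / 2"
  have u: "r < u" "u < t" "u < T (Suc k)"
    using assms(7,9) by (auto simp: u_def min_def field_simps)
  then have "s \<le> u" "u \<le> t" using assms(6) by simp_all
  then have "x u = x s" by (rule corner_const[OF assms(4,2,3)])
  moreover have "arc (T k)" using assms(1) by (simp add: h_def split: if_splits)
  then have "x u \<notin> V" using arcD1[of "T k" u] u assms(8) by (simp add: T_Suc)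
  ultimately show False using assms(5) by simp
qed

end

lemma map_filter_periodic:
  fixes P :: "nat \<Rightarrow> bool"
  assumes "\<And>k. P (k + q) = P k" "\<And>k. g (k + q) = g k"
  shows "map g (filter P [0..<m * q]) = concat (replicate m (map g (filter P [0..<q])))"
proof (induction m)
  case (Suc m)
  have "[0..<Suc m * q] = [0..<q] @ map (\<lambda>k. k + q) [0..<m * q]"
    using upt_add_eq_append[of 0 q "m * q"] map_add_upt[of q "m * q"]
    by (simp add: add.commute)
  moreover have "filter P (map (\<lambda>k. k + q) [0..<m * q]) = map (\<lambda>k. k + q) (filter P [0..<m * q])"
    by (simp add: filter_map o_def assms(1))
  ultimately show ?case by (simp add: o_def assms(2) Suc)
qed simp

section \<open>The star polygon read off from the sign sequence\<close>

context reuleaux_curve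
begin

text \<open>At a sign change the centre jumps by the full width, so breakpoints index the segments
  of the star polygon; \<open>k\<close> and \<open>k + N\<close> yield the same segment, which is
  why later lists stop at \<open>N\<close>.\<close>

definition breakpoint :: "nat \<Rightarrow> bool" where
  "breakpoint k \<longleftrightarrow> h k \<noteq> h (Suc k)"

lemma h_periodic: "h (k + 2 * N) = h k"
  using h_antiperiodic[of "k + N"] h_antiperiodic[of k] by (simp add: mult_2 add.assoc)

lemma c_periodic_mult: "c (k + m * N) = c k"
proof (induction m)
  case (Suc m)
  then show ?case using c_periodic[of "k + m * N"] by (simp add: algebra_simps)
qed simp

lemma breakpoint_periodic: "breakpoint (k + m * N) = breakpoint k"
proof (induction m)
  case (Suc m)
  have "breakpoint (k + m * N + N) = breakpoint (k + m * N)"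
    using h_antiperiodic[of "k + m * N"] h_antiperiodic[of "Suc (k + m * N)"]
    by (simp add: breakpoint_def)
  then show ?case using Suc by (simp add: algebra_simps)
qed simp

lemma c_mod: "c (k mod N) = c k"
  using c_periodic_mult[of "k mod N" "k div N"] by (simp add: mult.commute)

lemma breakpoint_mod: "breakpoint (k mod N) = breakpoint k"
  using breakpoint_periodic[of "k mod N" "k div N"] by (simp add: mult.commute)

lemma no_breakpoint:
  assumes "\<And>i. k \<le> i \<Longrightarrow> i < k + m \<Longrightarrow> \<not> breakpoint i"
  shows "c (k + m) = c k \<and> h (k + m) = h k"
  using assms
proof (induction m)
  case (Suc m)
  have IH: "c (k + m) = c k \<and> h (k + m) = h k" by (rule Suc.IH) (use Suc.prems in auto)
  have "h (k + m) = h (Suc (k + m))" using Suc.prems[of "k + m"] by (simp add: breakpoint_def)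
  then show ?case using center_step[of "k + m"] IH by simp
qed simp

text \<open>The two ends of a corner tile are normals at the same point \<open>c k\<close>; an arc
  tile shares its centre with the corner tile \<open>k + N\<close>.\<close>

lemma c_in_RV: "c k \<in> RV"
proof -
  have *: "c k \<in> RV" if "h k = -1" for k
  proof -
    have "x (T k) = c k" "x (T (Suc k)) = c k"
      using that a_bounds by (auto intro!: corner_center simp: T_Suc)
    then show ?thesis unfolding RV_eq using a_bounds
      by (intro CollectI exI[of _ "T k"] exI[of _ "T (Suc k)"]) (simp add: T_Suc)
  qed
  show ?thesis
    using *[of k] *[of "k + N"] h_sign[of k] h_antiperiodic[of k] c_periodic[of k] by auto
qed

lemma RV_shift:
  assumes "v \<in> RV"
  obtains s t where "b \<le> s" "s < t" "t < s + pi" "x s = v" "x t = v"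
proof -
  obtain s t where st: "s < t" "t < s + pi" "x s = v" "x t = v"
    using assms unfolding RV_eq by auto
  define m where "m = nat \<lceil>(b - s) / (2 * pi)\<rceil>"
  have "(b - s) / (2 * pi) \<le> real m" by (simp add: m_def of_nat_ceiling)
  then have "b \<le> s + 2 * pi * real m" by (simp add: field_simps)
  then show thesis using that[of "s + 2 * pi * real m" "t + 2 * pi * real m"] st
    by (simp add: periodic_nat)
qed

lemma RV_imp_c:
  assumes "v \<in> RV"
  obtains k where "v = c k"
proof -
  obtain s t where st: "t0 \<le> s" "s < t" "t < s + pi" "x s = v" "x t = v"
    using RV_shift[OF assms] .
  obtain k where k: "T k \<le> s" "s < T (Suc k)" using tile_cover[OF st(1)] .
  have "x s \<in> V" using assms RV_V st(4) by auto
  then have "h k \<noteq> 1" using not_const_arc[of k s t s] st k by auto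
  then have "h k = -1" using h_sign by blast
  then show thesis using corner_center[of k s] k st(4) that by auto
qed

lemma next_breakpoint:
  obtains j where "k \<le> j" "breakpoint j" "c j = c k"
proof -
  have "\<exists>j\<ge>k. breakpoint j"
  proof (rule ccontr)
    assume "\<not> ?thesis"
    then have "h (k + N) = h k" using no_breakpoint[of k N] by blast
    then show False using h_antiperiodic[of k] h_sign[of k] by auto
  qed
  then have ex: "\<exists>j. k \<le> j \<and> breakpoint j" by blast
  define j where "j = (LEAST j. k \<le> j \<and> breakpoint j)"
  have j: "k \<le> j" "breakpoint j" using LeastI_ex[OF ex] by (auto simp: j_def)
  have "\<not> breakpoint i" if "k \<le> i" "i < j" for i
    using not_less_Least[of i "\<lambda>j. k \<le> j \<and> breakpoint j"] that by (auto simp: j_def)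
  then have "c (k + (j - k)) = c k" using no_breakpoint[of k "j - k"] j(1) by simp
  then show thesis using that[of j] j by simp
qed

lemma RV_breakpoints: "RV = c ` {k. k < N \<and> breakpoint k}"
proof
  show "RV \<subseteq> c ` {k. k < N \<and> breakpoint k}"
  proof
    fix v assume "v \<in> RV"
    then obtain k where k: "v = c k" by (rule RV_imp_c)
    obtain j where "breakpoint j" "c j = c k" using next_breakpoint[of k] by metis
    then have "breakpoint (j mod N)" "v = c (j mod N)" "j mod N < N"
      using k N_gt_1 by (simp_all add: breakpoint_mod c_mod)
    then show "v \<in> c ` {k. k < N \<and> breakpoint k}" by blast
  qed
qed (use c_in_RV in auto)

text \<open>Normals at one point form an interval shorter than \<open>pi\<close>. A return to
  \<open>x (T M)\<close> within half a turn would make the arc tile \<open>M\<close> constant, and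
  after exactly half a turn the point is antipodal; so the return comes later. The stretch from
  there to \<open>M + 2 * N\<close>, again at the same point, is shorter than \<open>pi\<close> and
  contains no arc tile.\<close>

lemma corner_run:
  assumes "h M = 1" "h i = -1" "M \<le> i" "i < M + 2 * N" "c i = x (T M)" "i < l" "l < M + 2 * N"
  shows "h l = -1"
proof (rule ccontr)
  assume "h l \<noteq> -1"
  then have hl: "h l = 1" using h_sign by blast
  have Tl: "T k < T k'" if "k < k'" for k k' using that a_bounds by (simp add: T_def)
  have V: "c i \<in> V" using c_in_RV RV_V by blast
  have xi: "x (T i) = c i" "x (T (Suc i)) = c i"
    using assms(2) a_bounds by (auto intro!: corner_center simp: T_Suc)
  have Mi: "M < i" using assms(1-3) by (cases "M = i") auto
  consider "i < M + N" | "i = M + N" | "i > M + N" by linarith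
  then show False
  proof cases
    case 1
    have "T i < T M + pi" using Tl[OF 1] by (simp add: T_N)
    then show False
      using not_const_arc[of M "T M" "T i" "T M"] assms(1,5) Tl[OF Mi] Tl[of M "Suc M"] xi V by simp
  next
    case 2
    then show False using xi(1) assms(5) antipodal_neq[of "T M"] by (simp add: T_N)
  next
    case 3
    have 1: "T (Suc i) < T (M + 2 * N)" using assms(6,7) by (intro Tl) simp
    have 2: "T (M + 2 * N) < T (Suc i) + pi"
      using Tl[of "M + 2 * N" "Suc i + N"] 3 T_N[of "Suc i"] by simp
    have 3: "T (Suc i) \<le> T l" using Tl[of "Suc i" l] assms(6) by (cases "l = Suc i") auto
    have 4: "x (T (M + 2 * N)) = c i" using assms(5) periodic by (simp add: T_2N)
    show False
      using not_const_arc[of l "T (Suc i)" "T (M + 2 * N)" "T l"] hl 1 2 3 4 xi V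
        Tl[OF assms(7)] Tl[of l "Suc l"] by simp
  qed
qed

text \<open>Tile \<open>Suc j\<close> starts an arc at the point \<open>c k\<close>, and tile
  \<open>k\<close> is a corner there; by \<open>corner_run\<close> tile \<open>Suc k\<close> is a
  corner too, against the breakpoint at \<open>k\<close>.\<close>

lemma breakpoint_inj_aux:
  assumes "h j = -1" "h k = -1" "breakpoint j" "breakpoint k" "c j = c k" "j < k" "k < j + 2 * N"
  shows False
proof -
  have 1: "h (Suc j) = 1" "h (Suc k) = 1"
    using assms h_sign[of "Suc j"] h_sign[of "Suc k"] by (auto simp: breakpoint_def)
  have "x (T (Suc j)) = c k" using corner_center[of j "T (Suc j)"] assms(1,5) a_bounds
    by (simp add: T_Suc)
  then have "h (Suc k) = -1" using corner_run[of "Suc j" k "Suc k"] assms 1 by simp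
  then show False using 1 by simp
qed

lemma breakpoint_inj: "inj_on c {k. k < N \<and> breakpoint k}"
proof (rule inj_onI)
  fix j k assume jk: "j \<in> {k. k < N \<and> breakpoint k}" "k \<in> {k. k < N \<and> breakpoint k}" "c j = c k"
  \<comment> \<open>Of \<open>k\<close> and \<open>k + N\<close>, which share centre and breakpoint,
    one is a corner tile; these representatives within a full turn can be compared by
    \<open>breakpoint_inj_aux\<close>.\<close>
  have *: "\<exists>i<2 * N. h i = -1 \<and> breakpoint i \<and> c i = c k \<and> (i = k \<or> i = k + N)"
    if "k < N" "breakpoint k" for k
  proof (cases "h k = -1")
    case True
    then show ?thesis using that by (intro exI[of _ k]) auto
  next
    case False
    then have "h (k + N) = -1" using h_sign[of k] h_antiperiodic[of k] by auto
    then show ?thesis using that breakpoint_periodic[of k 1] c_periodic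
      by (intro exI[of _ "k + N"]) auto
  qed
  obtain j' where j': "j' < 2 * N" "h j' = -1" "breakpoint j'" "c j' = c j" "j' = j \<or> j' = j + N"
    using *[of j] jk by auto
  obtain k' where k': "k' < 2 * N" "h k' = -1" "breakpoint k'" "c k' = c k" "k' = k \<or> k' = k + N"
    using *[of k] jk by auto
  have "j' = k'"
    using breakpoint_inj_aux[of j' k'] breakpoint_inj_aux[of k' j'] j' k' jk(3)
    by (cases j' k' rule: linorder_cases) auto
  then show "j = k" using j' k' jk by auto
qed

lemma dist_center_step: "breakpoint k \<Longrightarrow> dist (c k) (c (Suc k)) = w"
proof -
  assume "breakpoint k"
  then have "\<bar>(real_of_int (h k) - h (Suc k)) / 2\<bar> = 1"
    using h_sign[of k] h_sign[of "Suc k"] by (auto simp: breakpoint_def)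
  moreover have "dist (c k) (c (Suc k)) = norm (c (Suc k) - c k)"
    by (metis dist_commute dist_norm)
  ultimately show ?thesis using w_pos
    by (simp only: center_step norm_mult norm_of_real norm_cis)
qed

text \<open>Were the junction of two arc tiles a vertex, a corner tile at the same point would occur
  within the next full turn, and \<open>corner_run\<close> would make every later tile of that turn
  a corner, including the arc tile \<open>j + 2 * N\<close>.\<close>

lemma no_arc_vertex:
  assumes "h j = 1" "h (Suc j) = 1" "x (T (Suc j)) \<in> RV"
  shows False
proof -
  define M where "M = Suc j"
  obtain k where k: "x (T M) = c k" using RV_imp_c[OF assms(3)] by (auto simp: M_def)
  \<comment> \<open>The representative of \<open>k\<close> modulo \<open>N\<close> in
    \<open>{M..<M + N}\<close>; adding \<open>N * M\<close> keeps the natural subtraction from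
    truncating.\<close>
  define i0 where "i0 = (k + N * M - M) mod N + M"
  have MN: "M \<le> N * M" using N_gt_1 by simp
  have "i0 mod N = (k + N * M - M + M) mod N" unfolding i0_def by (rule mod_add_left_eq)
  also have "k + N * M - M + M = k + N * M" using MN by linarith
  also have "(k + N * M) mod N = k mod N" by simp
  finally have ci0: "c i0 = c k" by (metis c_mod)
  have i0: "M \<le> i0" "i0 < M + N" using N_gt_1 by (simp_all add: i0_def)
  obtain i where i: "M \<le> i" "i < M + 2 * N" "h i = -1" "c i = x (T M)"
  proof (cases "h i0 = -1")
    case True
    then show thesis using that[of i0] i0 ci0 k by simp
  next
    case False
    then have "h (i0 + N) = -1" using h_sign[of i0] h_antiperiodic[of i0] by auto
    then show thesis using that[of "i0 + N"] i0 ci0 k c_periodic[of i0] by simp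
  qed
  have l: "h (j + 2 * N) = 1" using assms(1) h_periodic by simp
  then have "i \<noteq> j + 2 * N" using i(3) by (metis one_neq_neg_one)
  then have "h (j + 2 * N) = -1"
    using i assms(2) corner_run[of M i "j + 2 * N"] by (simp add: M_def)
  then show False using l by simp
qed

text \<open>A normal with vertices of \<open>R\<close> at both antipodal points is a node. Without a
  sign change there, two arc tiles would meet at it or at its antipode, which
  \<open>no_arc_vertex\<close> excludes. Hence segments of the star polygon occur only at
  breakpoints.\<close>

lemma antipodal_vertices:
  assumes "x u \<in> RV" "x (u + pi) \<in> RV"
  obtains k where "breakpoint k" "{x u, x (u + pi)} = {c k, c (Suc k)}"
proof -
  \<comment> \<open>Full turns move \<open>u\<close> beyond \<open>t0 + a\<close>, so that the node
    found has a tile before it.\<close>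
  define m where "m = nat \<lceil>(t0 + a - u) / (2 * pi)\<rceil>"
  have "(t0 + a - u) / (2 * pi) \<le> real m" by (simp add: m_def of_nat_ceiling)
  then have "t0 + a \<le> u + 2 * pi * real m" by (simp add: field_simps)
  then obtain t where t: "t0 + a \<le> t" "x t = x u" "x (t + pi) = x (u + pi)"
    using periodic_nat[of u m] periodic_nat[of "u + pi" m] by (simp add: algebra_simps)
  have "node t" using assms t RV_V by (auto simp: node_def)
  moreover have "t0 \<le> t" using t a_bounds by simp
  ultimately obtain k where k: "t = T k" by (rule node_imp_T)
  have "k \<noteq> 0"
  proof
    assume "k = 0"
    then show False using k t(1) a_bounds by (simp add: T_0)
  qed
  then obtain j where j: "k = Suc j" by (cases k) auto
  have Tj: "T j \<le> t" "t \<le> T (Suc j)" "T (Suc j) \<le> t" "t \<le> T (Suc (Suc j))"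
    using a_bounds by (simp_all add: k j T_Suc)
  have "breakpoint j"
  proof (rule ccontr)
    assume "\<not> breakpoint j"
    then have eq: "h (Suc j) = h j" by (simp add: breakpoint_def)
    show False
    proof (cases "h j = 1")
      case True
      then show False using no_arc_vertex[of j] eq assms(1) t k j by simp
    next
      case False
      then have "h (j + N) = 1" "h (Suc (j + N)) = 1"
        using h_sign[of j] h_antiperiodic[of j] h_antiperiodic[of "Suc j"] eq by auto
      moreover have "T (Suc (j + N)) = t + pi" using T_N[of "Suc j"] by (simp add: k j)
      ultimately show False using no_arc_vertex[of "j + N"] assms(2) t by simp
    qed
  qed
  moreover have "{x t, x (t + pi)} = {c j, c (Suc j)}"
  proof (cases "h j = 1")
    case True
    then have "h (Suc j) = -1" using \<open>breakpoint j\<close> h_sign[of "Suc j"] by (auto simp: breakpoint_def)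
    then show ?thesis using arc_center[OF True Tj(1,2)] corner_center[of "Suc j" t] Tj by auto
  next
    case False
    then have "h j = -1" using h_sign[of j] by blast
    moreover have "h (Suc j) = 1"
      using \<open>breakpoint j\<close> h_sign[of "Suc j"] calculation by (auto simp: breakpoint_def)
    ultimately show ?thesis using corner_center[of j t] arc_center[of "Suc j" t] Tj by auto
  qed
  ultimately show thesis using that[of j] t by simp
qed

text \<open>Advancing by \<open>q\<close> tiles multiplies every step between centres by
  \<open>r\<close>, so on centres the shift is a rotation followed by a translation, hence
  injective. The extra \<open>pi\<close> in \<open>r\<close> accounts for the flipped sign.\<close>

lemma center_rotation:
  assumes "\<And>k. h (k + q) = - h k"
  shows "c (j + q) = c (k + q) \<longleftrightarrow> c j = c k"
proof -
  define r where "r = cis (real q * a + pi)"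
  have "T (Suc k + q) = T (Suc k) + real q * a" for k by (rule T_add)
  then have cisT: "- cis (T (Suc k + q)) = r * cis (T (Suc k))" for k
    by (simp add: r_def cis_mult algebra_simps flip: cis_mult)
  have step: "c (Suc k + q) - c (k + q) = r * (c (Suc k) - c k)" for k
  proof -
    have "c (Suc k + q) - c (k + q) =
      of_real ((real_of_int (h k) - h (Suc k)) / 2) * (of_real w * - cis (T (Suc k + q)))"
      using center_step[of "k + q"] assms[of k] assms[of "Suc k"] by (simp add: algebra_simps minus_divide_left)
    then show ?thesis unfolding cisT center_step by (simp add: algebra_simps)
  qed
  have "c (k + q) - r * c k = c q - r * c 0" for k
  proof (induction k)
    case (Suc k)
    have "c (Suc k + q) - r * c (Suc k) = c (k + q) - r * c k"
      using step[of k] by (simp add: algebra_simps)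
    then show ?case using Suc by metis
  qed simp
  then have "c (k + q) = r * c k + (c q - r * c 0)" for k by (metis add.commute diff_add_cancel)
  moreover have "r \<noteq> 0" by (simp add: r_def)
  ultimately show ?thesis by simp
qed

definition breakpoints :: "nat list" where
  "breakpoints = filter breakpoint [0..<N]"

lemma set_breakpoints: "set breakpoints = {k. k < N \<and> breakpoint k}"
  by (auto simp: breakpoints_def)

text \<open>Centres are constant between breakpoints; beyond the last one the equality of
  \<open>c N\<close> and \<open>c 0\<close> closes the path.\<close>

lemma next_center:
  assumes i: "i < length breakpoints"
  shows "c (breakpoints ! (Suc i mod length breakpoints)) = c (Suc (breakpoints ! i))"
proof -
  let ?bs = breakpoints
  have srt: "sorted ?bs" by (simp add: breakpoints_def sorted_wrt_filter)
  have nb: "\<not> breakpoint b" if b: "?bs ! i < b" "b < N" "Suc i < length ?bs \<Longrightarrow> b < ?bs ! Suc i" for b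
  proof
    assume "breakpoint b"
    then obtain j where j: "j < length ?bs" "b = ?bs ! j"
      using b(2) set_breakpoints by (metis (mono_tags, lifting) in_set_conv_nth mem_Collect_eq)
    have "\<not> j \<le> i" using sorted_nth_mono[OF srt, of j i] i b(1) j by auto
    then have "Suc i \<le> j" by simp
    then show False using sorted_nth_mono[OF srt, of "Suc i" j] j b(3) by auto
  qed
  have biN: "?bs ! i < N" using nth_mem[OF i] set_breakpoints by auto
  show ?thesis
  proof (cases "Suc i < length ?bs")
    case True
    have lt: "?bs ! Suc i < N" using nth_mem[OF True] set_breakpoints by auto
    have "distinct ?bs" by (simp add: breakpoints_def)
    then have "?bs ! i \<noteq> ?bs ! Suc i" using i True by (simp add: nth_eq_iff_index_eq)
    moreover have "?bs ! i \<le> ?bs ! Suc i" using sorted_nth_mono[OF srt, of i "Suc i"] True by simp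
    ultimately have le: "Suc (?bs ! i) \<le> ?bs ! Suc i" by simp
    have "c (Suc (?bs ! i) + (?bs ! Suc i - Suc (?bs ! i))) = c (Suc (?bs ! i))"
      using no_breakpoint[of "Suc (?bs ! i)" "?bs ! Suc i - Suc (?bs ! i)"] nb lt le by simp
    then show ?thesis using le True by simp
  next
    case False
    have len: "Suc i = length ?bs" using i False by simp
    have "c (Suc (?bs ! i) + (N - Suc (?bs ! i))) = c (Suc (?bs ! i))"
      using no_breakpoint[of "Suc (?bs ! i)" "N - Suc (?bs ! i)"] nb biN False by simp
    then have 1: "c 0 = c (Suc (?bs ! i))" using c_periodic[of 0] biN by simp
    have l0: "0 < length ?bs" using i by linarith
    have "\<not> breakpoint b" if b: "b < ?bs ! 0" for b
    proof
      assume "breakpoint b"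
      moreover have "?bs ! 0 < N" using nth_mem[OF l0] set_breakpoints by auto
      ultimately obtain j where j: "j < length ?bs" "b = ?bs ! j"
        using b set_breakpoints
        by (metis (mono_tags, lifting) in_set_conv_nth mem_Collect_eq less_trans)
      then show False using sorted_nth_mono[OF srt, of 0 j] b by simp
    qed
    then have "c (0 + ?bs ! 0) = c 0" using no_breakpoint[of 0 "?bs ! 0"] by simp
    then show ?thesis using 1 len by simp
  qed
qed

lemma card_center_rotation:
  assumes "\<And>k. h (k + q) = - h k"
  shows "card {j. j < N \<and> c j = c (k + q)} = card {j. j < N \<and> c j = c k}"
proof -
  have cs: "int (card {j. j < N \<and> Q j}) = (\<Sum>j<N. if Q j then 1 else 0)" for Q
  proof -
    have "(\<Sum>j<N. if Q j then 1 else 0) = int (card ({..<N} \<inter> {j. Q j}))"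
      by (simp add: sum.If_cases)
    moreover have "{..<N} \<inter> {j. Q j} = {j. j < N \<and> Q j}" by auto
    ultimately show ?thesis by simp
  qed
  have "(\<Sum>j<N. if c (j + q) = c (k + q) then 1 else (0::int)) =
      (\<Sum>j<N. if c j = c (k + q) then 1 else 0)"
    by (rule sum_shift_periodic) (simp add: c_periodic)
  then have "int (card {j. j < N \<and> c j = c (k + q)}) = int (card {j. j < N \<and> c j = c k})"
    unfolding cs center_rotation[OF assms] by simp
  then show ?thesis by simp
qed

text \<open>Vertices are listed by the breakpoints below \<open>N\<close>. Breakpoints and counts
  per centre are both invariant under the shift by \<open>q\<close>, so the list over
  \<open>m * q\<close> indices is \<open>m\<close> copies of the one over \<open>q\<close>. The
  function \<open>F\<close> stands for the number of sides opposite to a vertex.\<close>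

lemma periodic_centers:
  assumes q: "\<And>k. h (k + q) = - h k" and N: "N = m * q"
    and F: "\<And>k. F (c k) = card {j. j < N \<and> c j = c k}"
  shows "\<exists>vs ks. distinct vs \<and> set vs = RV \<and>
     {{vs ! i, vs ! (Suc i mod length vs)} | i. i < length vs} =
       {{c k, c (Suc k)} | k. breakpoint k} \<and>
     map F vs = concat (replicate m ks)"
proof -
  define vs where "vs = map c breakpoints"
  have 1: "distinct vs" using breakpoint_inj
    by (simp add: vs_def distinct_map set_breakpoints breakpoints_def)
  have 2: "set vs = RV" by (simp add: vs_def set_breakpoints RV_breakpoints)
  have len: "length vs = length breakpoints" by (simp add: vs_def)
  have vsi: "{vs ! i, vs ! (Suc i mod length vs)} = {c (breakpoints ! i), c (Suc (breakpoints ! i))}"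
    if "i < length breakpoints" for i
  proof -
    have "0 < length breakpoints" using that by linarith
    then have "Suc i mod length breakpoints < length breakpoints" by (rule mod_less_divisor)
    then show ?thesis using that next_center[OF that] by (simp add: vs_def)
  qed
  have 3: "{{vs ! i, vs ! (Suc i mod length vs)} | i. i < length vs} =
       {{c k, c (Suc k)} | k. breakpoint k}" (is "?A = ?B")
  proof
    show "?A \<subseteq> ?B"
    proof
      fix e assume "e \<in> ?A"
      then obtain i where i: "e = {vs ! i, vs ! (Suc i mod length vs)}" "i < length breakpoints"
        using len by auto
      moreover have "breakpoint (breakpoints ! i)" using nth_mem[OF i(2)] set_breakpoints by auto
      ultimately show "e \<in> ?B" using vsi[OF i(2)] by blast
    qed
    show "?B \<subseteq> ?A"
    proof
      fix e assume "e \<in> ?B"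
      then obtain k where k: "e = {c k, c (Suc k)}" "breakpoint k" by auto
      have kN: "k mod N < N" using N_gt_1 by simp
      then have "k mod N \<in> set breakpoints" using k by (simp add: set_breakpoints breakpoint_mod)
      then obtain i where i: "i < length breakpoints" "breakpoints ! i = k mod N"
        by (auto simp: in_set_conv_nth)
      have "c (Suc (k mod N)) = c (Suc k)" using c_mod[of "Suc (k mod N)"] c_mod[of "Suc k"]
        by (simp add: mod_Suc_eq)
      then have "e = {vs ! i, vs ! (Suc i mod length vs)}" using vsi[OF i(1)] i(2) k c_mod by simp
      then show "e \<in> ?A" using i(1) len by auto
    qed
  qed
  define g where "g k = card {j. j < N \<and> c j = c k}" for k
  have "map F vs = map g (filter breakpoint [0..<m * q])"
    by (simp add: vs_def breakpoints_def F g_def o_def flip: N)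
  also have "\<dots> = concat (replicate m (map g (filter breakpoint [0..<q])))"
  proof (rule map_filter_periodic)
    show "breakpoint (k + q) = breakpoint k" for k
      using q[of k] q[of "Suc k"] by (simp add: breakpoint_def)
    show "g (k + q) = g k" for k
      unfolding g_def by (rule card_center_rotation[OF q])
  qed
  finally show ?thesis using 1 2 3 by blast
qed

end

section \<open>The support map of a Reuleaux polygon\<close>

lemma inner_cis: "cis t \<bullet> z = cos t * Re z + sin t * Im z"
  by (simp add: inner_complex_def)

lemma inner_cis_cis: "cis s \<bullet> (of_real r * cis t) = r * cos (t - s)"
  by (simp add: inner_complex_def cos_diff algebra_simps)

text \<open>Up to the factor \<open>sin (t - s)\<close>, writes \<open>cis m\<close> as a
  combination of \<open>cis s\<close> and \<open>cis t\<close> whose coefficients are nonnegative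
  for \<open>s <= m <= t <= s + pi\<close>: the cone argument for intermediate normals.\<close>

lemma sin_inner_cis_combination:
  "sin (t - s) * (cis m \<bullet> d) = sin (t - m) * (cis s \<bullet> d) + sin (m - s) * (cis t \<bullet> d)"
proof -
  have 1: "sin (t - s) * cos m = sin (t - m) * cos s + sin (m - s) * cos t"
    and 2: "sin (t - s) * sin m = sin (t - m) * sin s + sin (m - s) * sin t"
    by (simp_all add: sin_diff algebra_simps)
  show ?thesis unfolding inner_cis using 1 2 by (simp add: algebra_simps)
qed

lemma complex_polar:
  obtains t where "(z::complex) = of_real (norm z) * cis t"
  using rcis_cmod_Arg[of z] by (metis rcis_def)

text \<open>Equality case of the Cauchy-Schwarz inequality.\<close>

lemma eq_of_inner_eq_norm:
  assumes "cis t \<bullet> d = r" "norm d \<le> r"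
  shows "d = of_real r * cis t"
proof -
  have n: "(norm (of_real r * cis t))\<^sup>2 = r\<^sup>2" by (simp add: norm_mult)
  have "(norm (d - of_real r * cis t))\<^sup>2 = (norm d)\<^sup>2 - 2 * (d \<bullet> (of_real r * cis t)) + r\<^sup>2"
    using n by (simp add: power2_norm_eq_inner inner_diff_left inner_diff_right inner_commute)
  moreover have "d \<bullet> (of_real r * cis t) = r * (cis t \<bullet> d)"
    by (simp add: inner_complex_def algebra_simps)
  moreover have "(norm d)\<^sup>2 \<le> r\<^sup>2" using assms(2) by (intro power_mono) auto
  ultimately have "(norm (d - of_real r * cis t))\<^sup>2 \<le> 0"
    using assms(1) by (simp add: power2_eq_square)
  then show ?thesis by simp
qed

lemma finite_line_circle:
  fixes p d o' :: complex
  assumes "d \<noteq> 0"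
  shows "finite {t::real. dist o' (p + of_real t * d) = r}"
proof -
  define P where "P = [: (norm (p - o'))\<^sup>2 - r\<^sup>2, 2 * ((p - o') \<bullet> d), (norm d)\<^sup>2 :]"
  have "P \<noteq> 0" using assms by (simp add: P_def)
  then have "finite {t. poly P t = 0}" by (rule poly_roots_finite)
  moreover have "poly P t = 0" if "dist o' (p + of_real t * d) = r" for t
  proof -
    have "r\<^sup>2 = (norm ((p - o') + of_real t * d))\<^sup>2"
      using that by (metis add_diff_eq add.commute dist_commute dist_norm diff_add_eq)
    also have "\<dots> = (norm (p - o'))\<^sup>2 + 2 * t * ((p - o') \<bullet> d) + t\<^sup>2 * (norm d)\<^sup>2"
      unfolding cmod_power2 inner_complex_def by (simp add: power2_eq_square algebra_simps)
    finally show ?thesis by (simp add: P_def power2_eq_square algebra_simps)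
  qed
  ultimately show ?thesis by (elim rev_finite_subset) blast
qed

lemma circular_arc_subset_sphere:
  assumes "circular_arc r A"
  obtains o' where "\<And>z. z \<in> A \<Longrightarrow> dist o' z = r"
proof -
  obtain o' a b where "r > 0" "A = (\<lambda>t. o' + of_real r * cis t) ` {a..b}"
    using assms unfolding circular_arc_def by blast
  then have "dist o' z = r" if "z \<in> A" for z
    using that by (auto simp: dist_norm norm_mult)
  then show thesis by (rule that)
qed

lemma closed_circular_arc:
  assumes "circular_arc r A"
  shows "closed A"
proof -
  obtain o' a b where "A = (\<lambda>t. o' + of_real r * cis t) ` {a..b}"
    using assms unfolding circular_arc_def by blast
  then have "compact A" by (auto intro!: compact_continuous_image continuous_intros)
  then show ?thesis by (rule compact_imp_closed)
qed

locale reuleaux_body =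
  fixes R :: "complex set"
  assumes reuleaux: "reuleaux_polygon R"
begin

abbreviation "RV \<equiv> reuleaux_vertices R"

abbreviation "arcs \<equiv> boundary_arcs R"

lemma compact: "compact R" and convex: "convex R" and cw: "constant_width R"
  and finite_arcs: "finite arcs" and frontier_arcs: "frontier R = \<Union> arcs"
  and odd_RV: "odd (card RV)"
  using reuleaux unfolding reuleaux_polygon_def by blast+

lemma closed: "closed R" using compact by (rule compact_imp_closed)

definition \<rho> :: real where "\<rho> = (SOME r. \<forall>A\<in>arcs. circular_arc r A)"

lemma arc_rho: "A \<in> arcs \<Longrightarrow> circular_arc \<rho> A"
proof -
  have "\<exists>r. \<forall>A\<in>arcs. circular_arc r A" using reuleaux unfolding reuleaux_polygon_def by blast
  then have "\<forall>A\<in>arcs. circular_arc \<rho> A" unfolding \<rho>_def by (rule someI_ex)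
  then show "A \<in> arcs \<Longrightarrow> circular_arc \<rho> A" by blast
qed

lemma RV_frontier: "RV \<subseteq> frontier R"
  unfolding reuleaux_vertices_def frontier_arcs by blast

lemma frontier_R: "frontier R \<subseteq> R"
  using closed by (rule frontier_subset_closed)

lemma RV_nonempty: "RV \<noteq> {}"
  using odd_RV by auto

lemma R_nonempty: "R \<noteq> {}"
  using RV_nonempty RV_frontier frontier_R by blast

text \<open>A line meets each of the finitely many circles in finitely many points. This strict
  convexity is what makes support points unique.\<close>

lemma no_segment_in_frontier:
  assumes "p \<noteq> q"
  shows "\<not> closed_segment p q \<subseteq> frontier R"
proof
  assume sub: "closed_segment p q \<subseteq> frontier R"
  have fin: "finite {t::real. p + of_real t * (q - p) \<in> A}" if A: "A \<in> arcs" for A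
  proof -
    obtain o' where "\<And>z. z \<in> A \<Longrightarrow> dist o' z = \<rho>"
      using circular_arc_subset_sphere[OF arc_rho[OF A]] by blast
    then have "{t::real. p + of_real t * (q - p) \<in> A} \<subseteq> {t. dist o' (p + of_real t * (q - p)) = \<rho>}"
      by blast
    then show ?thesis using finite_line_circle[of "q - p" o' p \<rho>] assms finite_subset by auto
  qed
  have "{0..1} \<subseteq> (\<Union>A\<in>arcs. {t::real. p + of_real t * (q - p) \<in> A})"
  proof
    fix t :: real assume t: "t \<in> {0..1}"
    have "p + of_real t * (q - p) = (1 - t) *\<^sub>R p + t *\<^sub>R q"
      by (simp add: scaleR_conv_of_real algebra_simps)
    then have "p + of_real t * (q - p) \<in> closed_segment p q" using t by (auto simp: in_segment)
    then show "t \<in> (\<Union>A\<in>arcs. {t::real. p + of_real t * (q - p) \<in> A})"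
      using sub frontier_arcs by auto
  qed
  then have "finite {0..1::real}" using finite_arcs fin by (auto intro: finite_subset)
  then show False using infinite_Icc[of 0 "1::real"] by simp
qed

section \<open>Support points and constant width\<close>

definition supports :: "real \<Rightarrow> complex \<Rightarrow> bool" where
  "supports t z \<longleftrightarrow> z \<in> R \<and> (\<forall>y\<in>R. cis t \<bullet> y \<le> cis t \<bullet> z)"

lemma supports_frontier:
  assumes "supports t z"
  shows "z \<in> frontier R"
proof -
  have "z \<notin> interior R"
  proof
    assume "z \<in> interior R"
    then obtain e where e: "e > 0" "cball z e \<subseteq> R" by (auto simp: mem_interior_cball)
    have "z + of_real e * cis t \<in> R" using e by (auto simp: dist_norm norm_mult)
    then have "cis t \<bullet> (z + of_real e * cis t) \<le> cis t \<bullet> z" using assms by (simp add: supports_def)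
    then show False using e by (simp add: inner_add_right inner_cis_cis)
  qed
  then show ?thesis using assms closed by (simp add: supports_def frontier_def)
qed

lemma supports_unique:
  assumes "supports t p" "supports t q"
  shows "p = q"
proof (rule ccontr)
  assume ne: "p \<noteq> q"
  have eq: "cis t \<bullet> p = cis t \<bullet> q" using assms by (meson supports_def order_antisym)
  have "closed_segment p q \<subseteq> frontier R"
  proof
    fix z assume z: "z \<in> closed_segment p q"
    then obtain u where "z = (1 - u) *\<^sub>R p + u *\<^sub>R q" by (auto simp: in_segment)
    then have "cis t \<bullet> z = (1 - u) * (cis t \<bullet> p) + u * (cis t \<bullet> q)"
      by (simp only: inner_add_right inner_scaleR_right)
    then have "cis t \<bullet> z = cis t \<bullet> p" by (simp add: eq algebra_simps)
    moreover have "z \<in> R" using z assms convex closed_segment_subset by (metis supports_def subsetD)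
    ultimately have "supports t z" using assms by (simp add: supports_def)
    then show "z \<in> frontier R" by (rule supports_frontier)
  qed
  then show False using no_segment_in_frontier[OF ne] by blast
qed

definition supp :: "real \<Rightarrow> complex" where "supp t = (THE z. supports t z)"

lemma supports_supp: "supports t (supp t)"
proof -
  have "\<exists>z\<in>R. \<forall>y\<in>R. cis t \<bullet> y \<le> cis t \<bullet> z"
    by (intro continuous_attains_sup compact R_nonempty continuous_intros)
  then obtain z where "supports t z" by (auto simp: supports_def)
  then have "supp t = z" unfolding supp_def using supports_unique by blast
  then show ?thesis using \<open>supports t z\<close> by simp
qed

lemma supp_in: "supp t \<in> R" and supp_max: "y \<in> R \<Longrightarrow> cis t \<bullet> y \<le> cis t \<bullet> supp t"
  using supports_supp by (auto simp: supports_def)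

lemma supp_eqI: "z \<in> R \<Longrightarrow> (\<And>y. y \<in> R \<Longrightarrow> cis t \<bullet> y \<le> cis t \<bullet> z) \<Longrightarrow> supp t = z"
  using supports_unique[OF supports_supp, of t z] by (simp add: supports_def)

lemma supp_strict: "y \<in> R \<Longrightarrow> y \<noteq> supp t \<Longrightarrow> cis t \<bullet> y < cis t \<bullet> supp t"
  by (metis supp_eqI supp_max order_le_less order_trans)

lemma supp_frontier: "supp t \<in> frontier R"
  using supports_supp by (rule supports_frontier)

lemma supp_cong: "cis s = cis t \<Longrightarrow> supp s = supp t"
  by (simp add: supp_def supports_def)

lemma supp_periodic_int: "supp (t + 2 * pi * of_int k) = supp t"
proof (rule supp_cong)
  show "cis (t + 2 * pi * of_int k) = cis t" by (simp add: cis_2pi_int flip: cis_mult)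
qed

lemma frontier_imp_supp:
  assumes "z \<in> frontier R"
  obtains t where "z = supp t"
proof -
  have zR: "z \<in> R" using assms frontier_R by blast
  have "\<exists>a. a \<noteq> 0 \<and> (\<forall>y\<in>R. a \<bullet> y \<le> a \<bullet> z)"
  \<comment> \<open>With empty interior \<open>R\<close> lies on a line, whose normal supports every
    point; otherwise interior and relative interior agree.\<close>
  proof (cases "interior R = {}")
    case True
    then obtain a b where "a \<noteq> 0" "R \<subseteq> {x. a \<bullet> x = b}"
      using empty_interior_subset_hyperplane[OF convex] by metis
    then have "\<forall>y\<in>R. a \<bullet> y = b" by blast
    then show ?thesis using zR \<open>a \<noteq> 0\<close> by (intro exI[of _ a]) simp
  next
    case False
    then have "rel_interior R = interior R" by (rule rel_interior_nonempty_interior)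
    then have "z \<notin> rel_interior R" using assms by (simp add: frontier_def)
    moreover have "z \<in> closure R" using zR closure_subset by blast
    ultimately obtain a where "a \<noteq> 0" "\<And>y. y \<in> closure R \<Longrightarrow> a \<bullet> z \<le> a \<bullet> y"
      using supporting_hyperplane_relative_frontier[OF convex] by blast
    then show ?thesis using closure_subset by (intro exI[of _ "-a"]) auto
  qed
  then obtain a where a: "a \<noteq> 0" "\<And>y. y \<in> R \<Longrightarrow> a \<bullet> y \<le> a \<bullet> z" by blast
  have "a = of_real (norm a) * cis (Arg a)" using rcis_cmod_Arg[of a] by (simp add: rcis_def)
  then have "a = norm a *\<^sub>R cis (Arg a)" by (simp add: scaleR_conv_of_real)
  then have "norm a * (cis (Arg a) \<bullet> y) \<le> norm a * (cis (Arg a) \<bullet> z)" if "y \<in> R" for y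
    using a(2)[OF that] by (metis inner_scaleR_left)
  then have "cis (Arg a) \<bullet> y \<le> cis (Arg a) \<bullet> z" if "y \<in> R" for y
    using that a(1) by simp
  then have "supp (Arg a) = z" using zR by (intro supp_eqI)
  then show thesis using that by blast
qed

abbreviation "w \<equiv> diameter R"

lemma width_supp: "directional_width (cis t) R = cis t \<bullet> supp t - cis t \<bullet> supp (t + pi)"
proof -
  have "cis (t + pi) = - cis t" by (simp flip: cis_mult)
  then have min: "cis t \<bullet> supp (t + pi) \<le> cis t \<bullet> y" if "y \<in> R" for y
    using supp_max[OF that, of "t + pi"] by simp
  have "(SUP y\<in>R. cis t \<bullet> y) = cis t \<bullet> supp t"
    by (rule cSup_eq_maximum) (auto intro: supp_in supp_max)
  moreover have "(INF y\<in>R. cis t \<bullet> y) = cis t \<bullet> supp (t + pi)"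
    by (rule cInf_eq_minimum) (auto intro: supp_in min)
  ultimately show ?thesis by (simp add: directional_width_def)
qed

lemma dist_le_w: "y \<in> R \<Longrightarrow> z \<in> R \<Longrightarrow> norm (y - z) \<le> w"
  using diameter_bounded_bound[of R y z] compact by (simp add: compact_imp_bounded dist_norm)

text \<open>The constant width is the diameter: it is at most the distance of two points of
  \<open>R\<close>, and the direction of a diametral pair shows the converse.\<close>

lemma inner_diff_supp: "cis t \<bullet> (supp t - supp (t + pi)) = w"
proof -
  obtain w' where w': "\<And>u. norm u = 1 \<Longrightarrow> directional_width u R = w'"
    using cw unfolding constant_width_def by blast
  have *: "cis s \<bullet> (supp s - supp (s + pi)) = w'" for s
    using w'[of "cis s"] by (simp add: width_supp inner_diff_right)
  have "w' \<le> norm (supp t - supp (t + pi))"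
    using norm_cauchy_schwarz[of "cis t" "supp t - supp (t + pi)"] * by simp
  also have "\<dots> \<le> w" by (rule dist_le_w) (rule supp_in)+
  finally have "w' \<le> w" .
  moreover have "w \<le> w'"
  proof -
    obtain y z where yz: "y \<in> R" "z \<in> R" "dist y z = w"
      using diameter_compact_attained[OF compact R_nonempty] by blast
    obtain s where s: "y - z = of_real (norm (y - z)) * cis s" by (rule complex_polar)
    have "cis s \<bullet> (y - z) = norm (y - z)"
      by (subst s) (simp add: inner_cis_cis)
    also have "\<dots> = w" using yz by (simp add: dist_norm)
    finally have "w = cis s \<bullet> y - cis s \<bullet> z" by (simp add: inner_diff_right)
    moreover have "cis s \<bullet> y \<le> cis s \<bullet> supp s" using supp_max yz by blast
    moreover have "cis (s + pi) = - cis s" by (simp flip: cis_mult)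
    then have "cis s \<bullet> supp (s + pi) \<le> cis s \<bullet> z" using supp_max[OF yz(2), of "s + pi"] by simp
    ultimately show ?thesis using *[of s] by (simp add: inner_diff_right)
  qed
  ultimately show ?thesis using * by simp
qed

lemma supp_antipodal: "supp (t + pi) = supp t - of_real w * cis t"
proof -
  have "supp t - supp (t + pi) = of_real w * cis t"
    by (rule eq_of_inner_eq_norm[OF inner_diff_supp dist_le_w]) (rule supp_in)+
  then show ?thesis by (metis add.commute diff_add_cancel diff_eq_eq)
qed

lemma dist_w_imp_antipodal:
  assumes "y \<in> R" "z \<in> R" "dist y z = w"
  obtains t where "y = supp t" "z = supp (t + pi)"
proof -
  obtain s where s: "y - z = of_real (norm (y - z)) * cis s" by (rule complex_polar)
  have ws: "cis s \<bullet> (y - z) = w"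
    using assms by (subst s) (simp add: inner_cis_cis dist_norm)
  have ge: "cis s \<bullet> (supp s - supp (s + pi)) = w" by (rule inner_diff_supp)
  have "cis (s + pi) = - cis s" by (simp flip: cis_mult)
  then have lez: "cis s \<bullet> supp (s + pi) \<le> cis s \<bullet> z" using supp_max[OF assms(2), of "s + pi"] by simp
  have ley: "cis s \<bullet> y \<le> cis s \<bullet> supp s" using supp_max assms by blast
  have "y = supp s"
    using supp_strict[of y s] assms ws ge lez by (force simp: inner_diff_right)
  moreover have "z = supp (s + pi)"
  proof (rule ccontr)
    assume "z \<noteq> supp (s + pi)"
    then have "cis s \<bullet> supp (s + pi) < cis s \<bullet> z"
      using supp_strict[OF assms(2), of "s + pi"] \<open>cis (s + pi) = - cis s\<close> by simp
    then show False using ws ge ley by (simp add: inner_diff_right)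
  qed
  ultimately show thesis by (rule that)
qed

lemma w_pos: "w > 0"
proof (rule ccontr)
  assume "\<not> w > 0"
  then have "w = 0" using diameter_ge_0[OF compact_imp_bounded[OF compact]] by simp
  obtain v where "v \<in> RV" using RV_nonempty by blast
  then obtain A where A: "A \<in> arcs" unfolding reuleaux_vertices_def by blast
  then obtain o' a b where "\<rho> > 0" "a < b" "A = (\<lambda>t. o' + of_real \<rho> * cis t) ` {a..b}"
    using arc_rho unfolding circular_arc_def by blast
  \<comment> \<open>A full circle has coinciding ends; cutting the parameter interval to length at
    most 1 gives two distinct points.\<close>
  define b' where "b' = min b (a + 1)"
  have b': "a < b'" "b' \<le> b" "b' \<le> a + 1" using \<open>a < b\<close> by (auto simp: b'_def)
  have AR: "A \<subseteq> R" using A frontier_arcs frontier_R by blast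
  have "o' + of_real \<rho> * cis a \<in> R" "o' + of_real \<rho> * cis b' \<in> R"
    using AR b' \<open>a < b\<close> unfolding \<open>A = _\<close> by (auto intro!: imageI elim!: subsetD)
  then have "norm (o' + of_real \<rho> * cis a - (o' + of_real \<rho> * cis b')) \<le> 0"
    using dist_le_w \<open>w = 0\<close> by metis
  then have "cis a = cis b'" using \<open>\<rho> > 0\<close> by simp
  then show False using cis_eq_imp_eq[of a b'] b' pi_gt3 by simp
qed

text \<open>The graph is cut out by closed inequalities, and a map into a compact set with closed
  graph is continuous.\<close>

lemma continuous_supp: "continuous_on UNIV supp"
proof (rule continuous_from_closed_graph[OF compact])
  show "supp \<in> UNIV \<rightarrow> R" using supp_in by auto
  have "(\<lambda>t. (t, supp t)) ` UNIV =
      (UNIV \<times> R) \<inter> (\<Inter>y\<in>R. {p. cis (fst p) \<bullet> y \<le> cis (fst p) \<bullet> snd p})"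
  proof (intro equalityI subsetI)
    fix p assume "p \<in> (\<lambda>t. (t, supp t)) ` UNIV"
    then show "p \<in> (UNIV \<times> R) \<inter> (\<Inter>y\<in>R. {p. cis (fst p) \<bullet> y \<le> cis (fst p) \<bullet> snd p})"
      using supp_in supp_max by auto
  next
    fix p assume "p \<in> (UNIV \<times> R) \<inter> (\<Inter>y\<in>R. {p. cis (fst p) \<bullet> y \<le> cis (fst p) \<bullet> snd p})"
    then have "supp (fst p) = snd p" by (intro supp_eqI) auto
    then show "p \<in> (\<lambda>t. (t, supp t)) ` UNIV" by (metis prod.collapse rangeI)
  qed
  also have "closed \<dots>"
    by (intro closed_Int closed_Times closed_INT closed_UNIV closed ballI closed_Collect_le continuous_intros)
  finally show "closed ((\<lambda>t. (t, supp t)) ` UNIV)" .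
qed

text \<open>The normals at a point form a convex cone.\<close>

lemma corner_const:
  assumes "supp s = supp t" "s < t" "t < s + pi" "s \<le> u" "u \<le> t"
  shows "supp u = supp s"
proof (rule supp_eqI)
  show "supp s \<in> R" by (rule supp_in)
  fix y assume y: "y \<in> R"
  have pos: "sin (t - s) > 0" using assms by (intro sin_gt_zero) auto
  have "sin (t - u) \<ge> 0" "sin (u - s) \<ge> 0" using assms by (auto intro!: sin_ge_zero)
  moreover have "cis s \<bullet> y \<le> cis s \<bullet> supp s" "cis t \<bullet> y \<le> cis t \<bullet> supp s"
    using supp_max[OF y] assms(1) by metis+
  ultimately have "sin (t - s) * (cis u \<bullet> y) \<le> sin (t - s) * (cis u \<bullet> supp s)"
    unfolding sin_inner_cis_combination[of t s u] by (intro add_mono mult_left_mono)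
  then show "cis u \<bullet> y \<le> cis u \<bullet> supp s" using pos by simp
qed

lemma antipodal_neq: "supp (t + pi) \<noteq> supp t"
  using w_pos by (simp add: supp_antipodal)

section \<open>Vertices as points with several normals\<close>

definition corner :: "complex \<Rightarrow> bool" where
  "corner c \<longleftrightarrow> (\<exists>s t. s < t \<and> t < s + pi \<and> supp s = c \<and> supp t = c)"

text \<open>Full turns bring the difference of the angles into a half-open interval of length
  \<open>2 * pi\<close>; its end \<open>- pi\<close> is excluded because antipodal points
  differ.\<close>

lemma supp_eq_shift:
  assumes "supp s = supp t" "cis s \<noteq> cis t"
  obtains k :: int where "t + 2 * pi * of_int k \<noteq> s" "\<bar>t + 2 * pi * of_int k - s\<bar> < pi"
proof -
  define k where "k = - \<lfloor>(t - s + pi) / (2 * pi)\<rfloor>"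
  define t' where "t' = t + 2 * pi * of_int k"
  have "of_int (- k) \<le> (t - s + pi) / (2 * pi)" "(t - s + pi) / (2 * pi) < of_int (- k) + 1"
    unfolding k_def by linarith+
  then have b: "- pi \<le> t' - s" "t' - s < pi"
    using pi_gt_zero by (simp_all add: t'_def field_simps)
  have st: "supp t' = supp s" using assms(1) by (simp add: t'_def supp_periodic_int)
  have "t' \<noteq> s"
  proof
    assume "t' = s"
    have "cis t' = cis t" by (simp add: t'_def cis_2pi_int flip: cis_mult)
    then show False using assms(2) \<open>t' = s\<close> by simp
  qed
  moreover have "t' + pi \<noteq> s" using antipodal_neq[of t'] st by auto
  then have "\<bar>t' - s\<bar> < pi" using b by linarith
  ultimately show thesis using that[of k] by (simp add: t'_def)
qed

lemma not_corner_cis_eq: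
  assumes "supp s = supp t" "\<not> corner (supp s)"
  shows "cis s = cis t"
proof (rule ccontr)
  assume "cis s \<noteq> cis t"
  then obtain k :: int where k: "t + 2 * pi * of_int k \<noteq> s" "\<bar>t + 2 * pi * of_int k - s\<bar> < pi"
    using supp_eq_shift[OF assms(1)] by blast
  define t' where "t' = t + 2 * pi * of_int k"
  have st: "supp t' = supp s" using assms(1) by (simp add: t'_def supp_periodic_int)
  consider "s < t'" "t' < s + pi" | "t' < s" "s < t' + pi" using k unfolding t'_def by linarith
  then show False
    using assms(2) st unfolding corner_def by cases blast+
qed

text \<open>If \<open>cis s\<close> is a normal at the point with inner parameter \<open>t\<close>,
  then \<open>t\<close> maximises \<open>cos (u - s)\<close> over the arc. So it is a critical
  point, and the solution opposite to \<open>s\<close> would be a minimum. Hence arcs bulge outwards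
  and their parameter is the normal angle; continuity adds the ends.\<close>

lemma arc_supp:
  assumes "A \<in> arcs"
  obtains o' a b where "a < b" "b \<le> a + 2 * pi" "A = (\<lambda>t. o' + of_real \<rho> * cis t) ` {a..b}"
    "\<And>t. a \<le> t \<Longrightarrow> t \<le> b \<Longrightarrow> supp t = o' + of_real \<rho> * cis t"
proof -
  obtain o' a b where r: "\<rho> > 0" and ab: "a < b" "b \<le> a + 2 * pi"
    and A: "A = (\<lambda>t. o' + of_real \<rho> * cis t) ` {a..b}"
    using arc_rho[OF assms] unfolding circular_arc_def by blast
  have AR: "A \<subseteq> frontier R" using assms frontier_arcs by blast
  have int: "supp t - (o' + of_real \<rho> * cis t) = 0" if t: "a < t" "t < b" for t
  proof -
    have "o' + of_real \<rho> * cis t \<in> A" using t unfolding A by (intro imageI) simp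
    then have "o' + of_real \<rho> * cis t \<in> frontier R" using AR by blast
    then obtain s where s: "o' + of_real \<rho> * cis t = supp s" by (rule frontier_imp_supp)
    have le: "cos (u - s) \<le> cos (t - s)" if "a \<le> u" "u \<le> b" for u
    proof -
      have "o' + of_real \<rho> * cis u \<in> A" using that unfolding A by (intro imageI) simp
      then have "o' + of_real \<rho> * cis u \<in> R" using AR frontier_R by blast
      then have "cis s \<bullet> (o' + of_real \<rho> * cis u) \<le> cis s \<bullet> (o' + of_real \<rho> * cis t)"
        unfolding s by (rule supp_max)
      then show ?thesis using r by (simp add: inner_add_right inner_cis_cis)
    qed
    have d1: "((\<lambda>u. cos (u - s)) has_real_derivative - sin (t - s)) (at t)"
      by (auto intro!: derivative_eq_intros)
    have d2: "\<forall>u. \<bar>t - u\<bar> < min (t - a) (b - t) \<longrightarrow> cos (u - s) \<le> cos (t - s)"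
      using le by auto
    have "0 < min (t - a) (b - t)" using t by simp
    then have "- sin (t - s) = 0" using DERIV_local_max[OF d1 _ d2] by blast
    then have sin0: "sin (t - s) = 0" by simp
    have "cos (t - s) \<noteq> -1"
    proof
      assume m1: "cos (t - s) = -1"
      \<comment> \<open>A second parameter less than a turn away from \<open>t\<close>, at which the
        cosine would also have to be \<open>-1\<close>.\<close>
      define u where "u = max a (t - 1)"
      have u: "a \<le> u" "u < t" "u \<ge> t - 1" using t by (auto simp: u_def)
      then have "cos (u - s) \<le> -1" using le[of u] t m1 by simp
      then have c: "cos (u - s) = -1" using cos_ge_minus_one[of "u - s"] by linarith
      have "(sin (u - s))\<^sup>2 = 0" using c sin_squared_eq[of "u - s"] by simp
      then have "cis (u - s) = cis (t - s)" using c sin0 m1 by (simp add: complex_eq_iff)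
      then have "u - s = t - s" by (rule cis_eq_imp_eq) (use u pi_gt3 in auto)
      then show False using u by simp
    qed
    moreover have "(cos (t - s))\<^sup>2 = 1" using sin0 cos_squared_eq[of "t - s"] by simp
    ultimately have "cos (t - s) = 1" by (simp add: power2_eq_1_iff)
    then have "cis (t - s) = 1" using sin0 by (simp add: complex_eq_iff)
    then have "cis t = cis s" by (simp flip: cis_divide)
    then show ?thesis using supp_cong s by (metis right_minus_eq)
  qed
  have cl: "supp t = o' + of_real \<rho> * cis t" if "a \<le> t" "t \<le> b" for t
  proof -
    have "continuous_on (closure {a<..<b}) (\<lambda>t. supp t - (o' + of_real \<rho> * cis t))"
      by (intro continuous_intros continuous_on_subset[OF continuous_supp]) auto
    moreover have "t \<in> closure {a<..<b}" using ab that by simp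
    moreover have "supp u - (o' + of_real \<rho> * cis u) = 0" if "u \<in> {a<..<b}" for u
      using int that by simp
    ultimately have "supp t - (o' + of_real \<rho> * cis t) = 0"
      using continuous_constant_on_closure by blast
    then show ?thesis by simp
  qed
  show thesis using that[OF ab A cl] .
qed

lemma rho_pos: "\<rho> > 0"
proof -
  obtain v where "v \<in> RV" using RV_nonempty by blast
  then obtain A where "A \<in> arcs" unfolding reuleaux_vertices_def by blast
  then show ?thesis using arc_rho unfolding circular_arc_def by blast
qed

text \<open>Arcs of one circle with a common point unite to an arc inside the frontier; by
  maximality both equal the union.\<close>

lemma arc_eqI_same_circle:
  assumes "A \<in> arcs" "A = (\<lambda>t. o' + of_real \<rho> * cis t) ` {a..b}"
    and "B \<in> arcs" "B = (\<lambda>t. o' + of_real \<rho> * cis t) ` {a'..b'}"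
    and t: "t \<in> {a..b}" "t' \<in> {a'..b'}" "cis t = cis t'"
    and ab: "a < b"
  shows "A = B"
proof -
  let ?f = "\<lambda>t. o' + of_real \<rho> * cis t"
  obtain k :: int where k: "t = t' + 2 * pi * of_int k" using cis_eq_imp_int[OF t(3)] .
  define d where "d = 2 * pi * of_int k"
  have cisd: "cis (u + 2 * pi * of_int i) = cis u" for u and i :: int
    by (simp add: cis_2pi_int flip: cis_mult)
  have B: "B = ?f ` {a' + d..b' + d}"
  proof -
    have "?f ` {a' + d..b' + d} = ?f ` ((\<lambda>u. u + d) ` {a'..b'})" by simp
    also have "\<dots> = ?f ` {a'..b'}" unfolding image_image by (simp add: d_def cisd)
    finally show ?thesis using assms(4) by simp
  qed
  define m where "m = min a (a' + d)"
  define M where "M = max b (b' + d)"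
  have "{a..b} \<union> {a' + d..b' + d} = {m..M}"
    using t(1,2) k by (auto simp: m_def M_def d_def)
  then have U: "A \<union> B = ?f ` {m..M}" unfolding assms(2) B by (simp flip: image_Un)
  have mM: "m < M" using ab by (auto simp: m_def M_def)
  have "circular_arc \<rho> (A \<union> B)"
  proof (cases "M \<le> m + 2 * pi")
    case True
    then show ?thesis unfolding circular_arc_def U using rho_pos mM by blast
  next
    case False
    have "?f ` {m..M} = ?f ` {m..m + 2 * pi}"
    proof
      show "?f ` {m..M} \<subseteq> ?f ` {m..m + 2 * pi}"
      proof
        fix z assume "z \<in> ?f ` {m..M}"
        then obtain u where u: "m \<le> u" "z = ?f u" by auto
        define i where "i = - \<lfloor>(u - m) / (2 * pi)\<rfloor>"
        have "of_int (- i) \<le> (u - m) / (2 * pi)" "(u - m) / (2 * pi) < of_int (- i) + 1"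
          unfolding i_def by linarith+
        then have "m \<le> u + 2 * pi * of_int i" "u + 2 * pi * of_int i \<le> m + 2 * pi"
          using pi_gt_zero by (simp_all add: field_simps)
        moreover have "z = ?f (u + 2 * pi * of_int i)" using u by (simp add: cisd)
        ultimately show "z \<in> ?f ` {m..m + 2 * pi}" by auto
      qed
      show "?f ` {m..m + 2 * pi} \<subseteq> ?f ` {m..M}" using False by (intro image_mono) auto
    qed
    then show ?thesis unfolding circular_arc_def U using rho_pos pi_gt_zero
      by (intro conjI exI[of _ o'] exI[of _ m] exI[of _ "m + 2 * pi"]) auto
  qed
  moreover have "A \<union> B \<subseteq> frontier R" using assms(1,3) frontier_arcs by blast
  ultimately have "A \<union> B = A" "A \<union> B = B"
    using assms(1,3) unfolding boundary_arcs_def by blast+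
  then show ?thesis by simp
qed

text \<open>With a single normal at \<open>c\<close>, both arcs through \<open>c\<close> would have
  the same centre, since \<open>c\<close> is the centre plus \<open>\<rho>\<close> times that
  normal; so they would coincide.\<close>

lemma RV_imp_corner:
  assumes "c \<in> RV"
  shows "corner c"
proof (rule ccontr)
  assume nc: "\<not> corner c"
  obtain A B where AB: "A \<in> arcs" "B \<in> arcs" "A \<noteq> B" "c \<in> A" "c \<in> B"
    using assms unfolding reuleaux_vertices_def by blast
  obtain o1 a b where A: "a < b" "A = (\<lambda>t. o1 + of_real \<rho> * cis t) ` {a..b}"
    "\<And>t. a \<le> t \<Longrightarrow> t \<le> b \<Longrightarrow> supp t = o1 + of_real \<rho> * cis t"
    using arc_supp[OF AB(1)] by metis
  obtain o2 a' b' where B: "B = (\<lambda>t. o2 + of_real \<rho> * cis t) ` {a'..b'}"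
    "\<And>t. a' \<le> t \<Longrightarrow> t \<le> b' \<Longrightarrow> supp t = o2 + of_real \<rho> * cis t"
    using arc_supp[OF AB(2)] by metis
  obtain t where t: "t \<in> {a..b}" "c = o1 + of_real \<rho> * cis t" using AB(4) A(2) by blast
  obtain t' where t': "t' \<in> {a'..b'}" "c = o2 + of_real \<rho> * cis t'" using AB(5) B(1) by blast
  have "supp t = c" "supp t' = c" using A(3)[of t] B(2)[of t'] t t' by simp_all
  then have cis: "cis t = cis t'" using not_corner_cis_eq[of t t'] nc by simp
  then have "o1 = o2" using t(2) t'(2) by simp
  then show False
    using arc_eqI_same_circle[OF AB(1) A(2) AB(2) _ t(1) t'(1) cis A(1)] B(1) AB(3) by simp
qed

lemma closed_arc_set: "A \<in> arcs \<Longrightarrow> closed A"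
  using arc_rho by (rule closed_circular_arc)

text \<open>Near a point \<open>c\<close> on no other arc the boundary lies on \<open>A\<close>, so
  the points \<open>supp (\<theta> n)\<close> eventually have parameters on \<open>A\<close>,
  accumulating at some \<open>l\<close> with \<open>supp l = c\<close>. The point is that
  \<open>l\<close> and \<open>t\<close> are the same direction, although \<open>c\<close> might have
  many normals.\<close>

lemma limit_on_arc:
  assumes c: "c \<notin> RV" "c \<in> A" and A: "A \<in> arcs"
    and Aeq: "A = (\<lambda>t. o' + of_real \<rho> * cis t) ` {a..b}"
    and sA: "\<And>t. a \<le> t \<Longrightarrow> t \<le> b \<Longrightarrow> supp t = o' + of_real \<rho> * cis t"
    and th: "\<theta> \<longlonglongrightarrow> t" "supp t = c" "\<And>n. supp (\<theta> n) \<noteq> c"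
  shows "c = o' + of_real \<rho> * cis t"
proof -
  have "closed (\<Union>(arcs - {A}))"
    using finite_arcs closed_arc_set by (intro closed_Union) auto
  then have "open (- \<Union>(arcs - {A}))" by (rule open_Compl)
  moreover have "c \<in> - \<Union>(arcs - {A})"
    using c A unfolding reuleaux_vertices_def by blast
  moreover have suppc: "(\<lambda>n. supp (f n)) \<longlonglongrightarrow> supp l" if "f \<longlonglongrightarrow> l" for f l
    using continuous_on_tendsto_compose[OF continuous_supp that] by simp
  then have "(\<lambda>n. supp (\<theta> n)) \<longlonglongrightarrow> c" using th by metis
  ultimately have "eventually (\<lambda>n. supp (\<theta> n) \<in> - \<Union>(arcs - {A})) sequentially"
    by (metis topological_tendstoD)
  then obtain n0 where n0: "\<And>n. n \<ge> n0 \<Longrightarrow> supp (\<theta> n) \<in> - \<Union>(arcs - {A})"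
    by (auto simp: eventually_sequentially)
  have "\<exists>s\<in>{a..b}. supp (\<theta> (n + n0)) = supp s" for n
  proof -
    have "supp (\<theta> (n + n0)) \<in> \<Union> arcs" using supp_frontier frontier_arcs by blast
    then have "supp (\<theta> (n + n0)) \<in> A" using n0[of "n + n0"] by auto
    then show ?thesis using Aeq sA by auto
  qed
  then obtain s where s: "\<And>n. s n \<in> {a..b}" "\<And>n. supp (\<theta> (n + n0)) = supp (s n)" by metis
  have "seq_compact {a..b}" using compact_Icc by (rule compact_imp_seq_compact)
  then obtain l r where l: "l \<in> {a..b}" "strict_mono r" "(s \<circ> r) \<longlonglongrightarrow> l"
    using s(1) unfolding seq_compact_def by metis
  have th': "(\<lambda>n. \<theta> (r n + n0)) \<longlonglongrightarrow> t"
  proof -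
    have "(\<lambda>n. \<theta> (n + n0)) \<longlonglongrightarrow> t" using th(1) by (rule LIMSEQ_ignore_initial_segment)
    then show ?thesis using LIMSEQ_subseq_LIMSEQ[OF _ l(2)] by (simp add: o_def)
  qed
  have "(\<lambda>n. supp (s (r n))) \<longlonglongrightarrow> supp l" using suppc[OF l(3)] by (simp add: o_def)
  moreover have "(\<lambda>n. supp (s (r n))) \<longlonglongrightarrow> c"
    using suppc[OF th'] s(2) th(2) by simp
  ultimately have lc: "supp l = c" by (rule LIMSEQ_unique)
  have "cis l = cis t"
  proof (rule ccontr)
    assume "cis l \<noteq> cis t"
    then obtain k :: int where k: "l + 2 * pi * of_int k \<noteq> t" "\<bar>l + 2 * pi * of_int k - t\<bar> < pi"
      using supp_eq_shift[of t l] lc th(2) by metis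
    define l' where "l' = l + 2 * pi * of_int k"
    define \<sigma> where "\<sigma> n = s (r n) + 2 * pi * of_int k" for n
    define \<phi> where "\<phi> n = \<theta> (r n + n0)" for n
    have "(\<lambda>n. s (r n)) \<longlonglongrightarrow> l" using l(3) by (simp add: o_def)
    then have sl: "\<sigma> \<longlonglongrightarrow> l'" unfolding \<sigma>_def l'_def by (intro tendsto_intros)
    have pl: "\<phi> \<longlonglongrightarrow> t" using th' unfolding \<phi>_def .
    have l'c: "supp l' = c" using lc by (simp add: l'_def supp_periodic_int)
    have eq: "supp (\<sigma> n) = supp (\<phi> n)" for n
      using s(2)[of "r n"] by (simp add: \<sigma>_def \<phi>_def supp_periodic_int)
    have nc: "supp (\<phi> n) \<noteq> c" for n using th(3) by (simp add: \<phi>_def)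
    \<comment> \<open>If \<open>l'\<close> and \<open>t\<close> differ, \<open>\<mu>\<close> is a
      normal at \<open>c\<close>. Eventually \<open>\<sigma> n\<close> and \<open>\<phi> n\<close>
      lie on opposite sides of it and are normals at a common point, which would then be
      \<open>c\<close>.\<close>
    define \<mu> where "\<mu> = (l' + t) / 2"
    consider "l' < t" "t < l' + pi" | "t < l'" "l' < t + pi" using k unfolding l'_def by linarith
    then show False
    proof cases
      case 1
      have mu: "supp \<mu> = c" using corner_const[of l' t \<mu>] 1 l'c th(2) by (simp add: \<mu>_def)
      have "l' < \<mu>" "\<mu> < t" using 1 by (simp_all add: \<mu>_def)
      then have "eventually (\<lambda>n. \<sigma> n < \<mu>) sequentially" "eventually (\<lambda>n. \<mu> < \<phi> n) sequentially"
        using order_tendstoD(2)[OF sl] order_tendstoD(1)[OF pl] by blast+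
      moreover have "eventually (\<lambda>n. \<phi> n - \<sigma> n < pi) sequentially"
        using order_tendstoD(2)[OF tendsto_diff[OF pl sl], of pi] 1 by simp
      ultimately have "eventually (\<lambda>n. \<sigma> n < \<mu> \<and> \<mu> < \<phi> n \<and> \<phi> n - \<sigma> n < pi) sequentially"
        by eventually_elim simp
      then obtain n where n: "\<sigma> n < \<mu>" "\<mu> < \<phi> n" "\<phi> n - \<sigma> n < pi"
        by (auto simp: eventually_sequentially)
      then have "supp \<mu> = supp (\<sigma> n)" using corner_const[OF eq, of n \<mu>] by simp
      then show False using eq[of n] nc[of n] mu by metis
    next
      case 2
      have mu: "supp \<mu> = c" using corner_const[of t l' \<mu>] 2 l'c th(2) by (simp add: \<mu>_def)
      have "\<mu> < l'" "t < \<mu>" using 2 by (simp_all add: \<mu>_def)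
      then have "eventually (\<lambda>n. \<phi> n < \<mu>) sequentially" "eventually (\<lambda>n. \<mu> < \<sigma> n) sequentially"
        using order_tendstoD(1)[OF sl] order_tendstoD(2)[OF pl] by blast+
      moreover have "eventually (\<lambda>n. \<sigma> n - \<phi> n < pi) sequentially"
        using order_tendstoD(2)[OF tendsto_diff[OF sl pl], of pi] 2 by simp
      ultimately have "eventually (\<lambda>n. \<phi> n < \<mu> \<and> \<mu> < \<sigma> n \<and> \<sigma> n - \<phi> n < pi) sequentially"
        by eventually_elim simp
      then obtain n where n: "\<phi> n < \<mu>" "\<mu> < \<sigma> n" "\<sigma> n - \<phi> n < pi"
        by (auto simp: eventually_sequentially)
      then have "supp \<mu> = supp (\<phi> n)" using corner_const[OF eq[symmetric], of n \<mu>] by simp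
      then show False using nc[of n] mu by metis
    qed
  qed
  moreover have "c = o' + of_real \<rho> * cis l" using sA[of l] l(1) lc by simp
  ultimately show ?thesis by simp
qed

text \<open>Let \<open>c\<close> lie on a single arc. Its first and last normals are limits of
  normals at other boundary points, so \<open>limit_on_arc\<close> expresses \<open>c\<close> by
  either of them over the same centre. The two extreme normals then coincide, against
  \<open>\<alpha> < \<beta>\<close>.\<close>

lemma corner_imp_RV:
  assumes "corner c"
  shows "c \<in> RV"
proof (rule ccontr)
  assume nRV: "c \<notin> RV"
  obtain \<alpha> \<beta> where ab: "\<alpha> < \<beta>" "\<beta> < \<alpha> + pi" "supp \<alpha> = c" "supp \<beta> = c"
    using assms unfolding corner_def by blast
  have "c \<in> frontier R" using supp_frontier ab by metis
  then obtain A where A: "A \<in> arcs" "c \<in> A" unfolding frontier_arcs by blast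
  obtain o' a b where Aeq: "A = (\<lambda>t. o' + of_real \<rho> * cis t) ` {a..b}"
    and sA: "\<And>t. a \<le> t \<Longrightarrow> t \<le> b \<Longrightarrow> supp t = o' + of_real \<rho> * cis t"
    using arc_supp[OF A(1)] by metis
  note lim = limit_on_arc[OF nRV A(2,1) Aeq sA]
  have clc: "closed (supp -` {c})" by (rule closed_vimage[OF _ continuous_supp]) simp
  have nb: "supp (\<alpha> + pi) \<noteq> c" "supp (\<beta> - pi) \<noteq> c"
    using antipodal_neq[of \<alpha>] antipodal_neq[of "\<beta> - pi"] ab by auto
  have "\<exists>\<beta>'. \<beta> \<le> \<beta>' \<and> \<beta>' < \<alpha> + pi \<and> c = o' + of_real \<rho> * cis \<beta>'"
  proof -
    define S where "S = supp -` {c} \<inter> {\<beta>..\<alpha> + pi}"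
    have "\<beta> \<in> S" using ab by (simp add: S_def)
    moreover have bdd: "bdd_above S" unfolding S_def by (intro bdd_above_Int2) simp
    moreover have "closed S" using clc unfolding S_def by (intro closed_Int) auto
    ultimately have S: "Sup S \<in> S" by (metis closed_contains_Sup empty_iff)
    then have s: "supp (Sup S) = c" "\<beta> \<le> Sup S" "Sup S \<le> \<alpha> + pi" by (simp_all add: S_def)
    then have s': "Sup S < \<alpha> + pi" using nb(1) by (metis order_le_less)
    \<comment> \<open>Approaches the last normal at \<open>c\<close> from outside; not exceeding
      \<open>\<alpha> + pi\<close> keeps it in the range over which \<open>Sup S\<close> is
      maximal.\<close>
    define \<theta> where "\<theta> n = Sup S + (\<alpha> + pi - Sup S) * inverse (real (Suc n))" for n
    have "\<theta> \<longlonglongrightarrow> Sup S + (\<alpha> + pi - Sup S) * 0"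
      unfolding \<theta>_def by (intro tendsto_intros LIMSEQ_inverse_real_of_nat)
    then have "\<theta> \<longlonglongrightarrow> Sup S" by simp
    moreover have "supp (\<theta> n) \<noteq> c" for n
    proof
      assume "supp (\<theta> n) = c"
      moreover have gt: "Sup S < \<theta> n" using s' by (simp add: \<theta>_def)
      moreover have "inverse (real (Suc n)) \<le> 1" by (simp add: inverse_le_1_iff)
      then have "(\<alpha> + pi - Sup S) * inverse (real (Suc n)) \<le> (\<alpha> + pi - Sup S) * 1"
        using s' by (intro mult_left_mono) auto
      then have "\<theta> n \<le> \<alpha> + pi" by (simp add: \<theta>_def)
      ultimately have "\<theta> n \<in> S" using s(2) by (simp add: S_def)
      then show False using cSup_upper[OF _ bdd] gt by fastforce
    qed
    ultimately have "c = o' + of_real \<rho> * cis (Sup S)" using lim s(1) by blast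
    then show ?thesis using s s' by blast
  qed
  moreover have "\<exists>\<alpha>'. \<beta> - pi < \<alpha>' \<and> \<alpha>' \<le> \<alpha> \<and> c = o' + of_real \<rho> * cis \<alpha>'"
  proof -
    define S where "S = supp -` {c} \<inter> {\<beta> - pi..\<alpha>}"
    have "\<alpha> \<in> S" using ab by (simp add: S_def)
    moreover have bdd: "bdd_below S" unfolding S_def by (intro bdd_below_Int2) simp
    moreover have "closed S" using clc unfolding S_def by (intro closed_Int) auto
    ultimately have S: "Inf S \<in> S" by (metis closed_contains_Inf empty_iff)
    then have s: "supp (Inf S) = c" "\<beta> - pi \<le> Inf S" "Inf S \<le> \<alpha>" by (simp_all add: S_def)
    then have s': "\<beta> - pi < Inf S" using nb(2) by (metis order_le_less)
    define \<theta> where "\<theta> n = Inf S - (Inf S - (\<beta> - pi)) * inverse (real (Suc n))" for n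
    have "\<theta> \<longlonglongrightarrow> Inf S - (Inf S - (\<beta> - pi)) * 0"
      unfolding \<theta>_def by (intro tendsto_intros LIMSEQ_inverse_real_of_nat)
    then have "\<theta> \<longlonglongrightarrow> Inf S" by simp
    moreover have "supp (\<theta> n) \<noteq> c" for n
    proof
      assume "supp (\<theta> n) = c"
      moreover have gt: "\<theta> n < Inf S" using s' by (simp add: \<theta>_def)
      moreover have "inverse (real (Suc n)) \<le> 1" by (simp add: inverse_le_1_iff)
      then have "(Inf S - (\<beta> - pi)) * inverse (real (Suc n)) \<le> (Inf S - (\<beta> - pi)) * 1"
        using s' by (intro mult_left_mono) auto
      then have "\<beta> - pi \<le> \<theta> n" by (simp add: \<theta>_def)
      ultimately have "\<theta> n \<in> S" using s(3) by (simp add: S_def)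
      then show False using cInf_lower[OF _ bdd] gt by fastforce
    qed
    ultimately have "c = o' + of_real \<rho> * cis (Inf S)" using lim s(1) by blast
    then show ?thesis using s s' by blast
  qed
  ultimately obtain \<alpha>' \<beta>' where 1: "\<beta> \<le> \<beta>'" "\<beta>' < \<alpha> + pi" "\<beta> - pi < \<alpha>'" "\<alpha>' \<le> \<alpha>"
    and "c = o' + of_real \<rho> * cis \<beta>'" "c = o' + of_real \<rho> * cis \<alpha>'" by blast
  then have "cis \<beta>' = cis \<alpha>'" using rho_pos by simp
  moreover have "\<bar>\<beta>' - \<alpha>'\<bar> < 2 * pi" using 1 ab by linarith
  ultimately have "\<beta>' = \<alpha>'" by (rule cis_eq_imp_eq)
  then show False using 1 ab by simp
qed

lemma RV_eq: "RV = {supp s | s t. s < t \<and> t < s + pi \<and> supp s = supp t}"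
  using RV_imp_corner corner_imp_RV unfolding corner_def by fastforce

lemma smooth_on_arc:
  assumes "A \<in> arcs" "A = (\<lambda>t. o' + of_real \<rho> * cis t) ` {a..b}"
    "\<And>t. a \<le> t \<Longrightarrow> t \<le> b \<Longrightarrow> supp t = o' + of_real \<rho> * cis t"
    "supp t \<in> A" "supp t \<notin> RV"
  shows "supp t = o' + of_real \<rho> * cis t"
proof -
  obtain s where s: "a \<le> s" "s \<le> b" "supp t = o' + of_real \<rho> * cis s" using assms(2,4) by auto
  then have "supp t = supp s" using assms(3) by simp
  then have "cis t = cis s" using not_corner_cis_eq[of t s] assms(5) corner_imp_RV by blast
  then show ?thesis using s by simp
qed

lemma arc_of_supp:
  obtains A where "A \<in> arcs" "supp t \<in> A"
  using supp_frontier[of t] unfolding frontier_arcs by blast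

text \<open>Facing a vertex \<open>c\<close> the boundary runs on the circle of radius
  \<open>w\<close> about \<open>c\<close>. Infinitely many normals there belong to one boundary arc,
  and two of them already force the radii to agree.\<close>

lemma rho_eq_w: "\<rho> = w"
proof -
  obtain c where "c \<in> RV" using RV_nonempty by blast
  then obtain \<alpha> \<beta> where ab: "\<alpha> < \<beta>" "\<beta> < \<alpha> + pi" "supp \<alpha> = c" "supp \<beta> = c"
    using RV_imp_corner unfolding corner_def by blast
  define I where "I = {\<alpha> + pi<..<\<beta> + pi}"
  have xI: "supp t = c + of_real w * cis t" if "t \<in> I" for t
  proof -
    have t: "\<alpha> \<le> t - pi" "t - pi \<le> \<beta>" using that by (auto simp: I_def)
    have "supp (t - pi) = c" using corner_const[of \<alpha> \<beta> "t - pi"] ab t by simp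
    then show ?thesis using supp_antipodal[of "t - pi"] by (simp flip: cis_divide)
  qed
  \<comment> \<open>A vertex here would have a second normal, hence by \<open>corner_const\<close>
    another one inside \<open>I\<close>, where the boundary point is injective in the angle.\<close>
  have notRV: "supp t \<notin> RV" if tI: "t \<in> I" for t
  proof
    assume "supp t \<in> RV"
    then obtain u v where uv: "u < v" "v < u + pi" "supp u = supp t" "supp v = supp t"
      using RV_imp_corner unfolding corner_def by blast
    obtain s where s: "cis s \<noteq> cis t" "supp s = supp t"
    proof (cases "cis u = cis t")
      case True
      then have "cis v \<noteq> cis t" using cis_eq_imp_eq[of v u] uv by auto
      then show thesis using that uv by blast
    qed (use that uv in blast)
    obtain k :: int where k: "s + 2 * pi * of_int k \<noteq> t" "\<bar>s + 2 * pi * of_int k - t\<bar> < pi"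
      using supp_eq_shift[of t s] s by metis
    define s' where "s' = s + 2 * pi * of_int k"
    have s't: "supp s' = supp t" using s by (simp add: s'_def supp_periodic_int)
    have contra: False if "u \<in> I" "supp u = supp t" "u \<noteq> t" for u
    proof -
      have "cis u = cis t" using xI[OF that(1)] xI[OF tI] that(2) w_pos by simp
      moreover have "\<bar>u - t\<bar> < 2 * pi" using that(1) tI ab unfolding I_def by auto
      ultimately have "u = t" by (rule cis_eq_imp_eq)
      then show False using that by simp
    qed
    consider "t < s'" "s' < t + pi" | "s' < t" "t < s' + pi" using k unfolding s'_def by linarith
    then show False
    proof cases
      case 1
      define u where "u = (t + min s' (\<beta> + pi)) / 2"
      have "t < u" "u \<le> s'" "u \<in> I" using 1 tI by (auto simp: u_def I_def min_def field_simps)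
      moreover have "supp u = supp t" using corner_const[of t s' u] 1 s't calculation by simp
      ultimately show False using contra[of u] by simp
    next
      case 2
      define u where "u = (t + max s' (\<alpha> + pi)) / 2"
      have "u < t" "s' \<le> u" "u \<in> I" using 2 tI by (auto simp: u_def I_def max_def field_simps)
      moreover have "supp u = supp s'" using corner_const[of s' t u] 2 s't calculation by simp
      ultimately show False using contra[of u] s't by simp
    qed
  qed
  have "infinite I" using ab by (simp add: I_def infinite_Ioo)
  moreover have "I = (\<Union>A\<in>arcs. {t \<in> I. supp t \<in> A})" using arc_of_supp by blast
  ultimately obtain A where A: "A \<in> arcs" "infinite {t \<in> I. supp t \<in> A}"
    using finite_arcs by (metis (no_types, lifting) finite_UN_I)
  obtain o' a b where Aeq: "A = (\<lambda>t. o' + of_real \<rho> * cis t) ` {a..b}"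
    and sA: "\<And>t. a \<le> t \<Longrightarrow> t \<le> b \<Longrightarrow> supp t = o' + of_real \<rho> * cis t"
    using arc_supp[OF A(1)] by metis
  obtain t where t: "t \<in> I" "supp t \<in> A" using A(2) by (metis (mono_tags, lifting) finite.emptyI
        empty_Collect_eq)
  have "infinite ({t \<in> I. supp t \<in> A} - {t})" using A(2) by simp
  then obtain u where u: "u \<in> I" "supp u \<in> A" "u \<noteq> t"
    by (metis (mono_tags, lifting) DiffE finite.emptyI ex_in_conv mem_Collect_eq singletonI)
  have "o' + of_real \<rho> * cis t = c + of_real w * cis t" "o' + of_real \<rho> * cis u = c + of_real w * cis u"
    using smooth_on_arc[OF A(1) Aeq sA] t u notRV xI by metis+
  then have "(o' + of_real \<rho> * cis t) - (o' + of_real \<rho> * cis u) =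
      (c + of_real w * cis t) - (c + of_real w * cis u)" by (simp only:)
  then have "(of_real \<rho> - of_real w) * (cis t - cis u) = (0::complex)" by (simp add: algebra_simps)
  moreover have "\<bar>t - u\<bar> < 2 * pi" using t(1) u(1) ab unfolding I_def by auto
  then have "cis t \<noteq> cis u" using cis_eq_imp_eq[of t u] u(3) by blast
  ultimately show ?thesis by simp
qed

text \<open>A boundary point that is no vertex lies on an arc at the parameter of its own normal,
  and as \<open>\<rho> = w\<close> its opposite point is the centre. That centre faces the whole
  arc, so it has several normals.\<close>

lemma supp_cover: "supp t \<in> RV \<or> supp (t + pi) \<in> RV"
proof (rule disjCI)
  assume n: "supp (t + pi) \<notin> RV"
  show "supp t \<in> RV"
  proof (rule ccontr)
    assume nt: "supp t \<notin> RV"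
    obtain A where A: "A \<in> arcs" "supp t \<in> A" by (rule arc_of_supp)
    obtain o' a b where ab: "a < b" and Aeq: "A = (\<lambda>t. o' + of_real \<rho> * cis t) ` {a..b}"
      and sA: "\<And>t. a \<le> t \<Longrightarrow> t \<le> b \<Longrightarrow> supp t = o' + of_real \<rho> * cis t"
      using arc_supp[OF A(1)] by metis
    have "supp t = o' + of_real \<rho> * cis t" by (rule smooth_on_arc[OF A(1) Aeq sA A(2) nt])
    then have "supp (t + pi) = o'" by (simp add: supp_antipodal rho_eq_w)
    moreover have "o' \<in> RV"
    proof -
      define b' where "b' = min b (a + 1)"
      have b': "a < b'" "b' \<le> b" "b' < a + pi" using ab pi_gt3 by (auto simp: b'_def)
      have "supp (a + pi) = o'" "supp (b' + pi) = o'"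
        using sA[of a] sA[of b'] b' by (simp_all add: supp_antipodal rho_eq_w)
      then show ?thesis using b' unfolding RV_eq
        by (intro CollectI exI[of _ "a + pi"] exI[of _ "b' + pi"]) simp
    qed
    ultimately show False using n by simp
  qed
qed

end

section \<open>Inscribed equilateral polygons\<close>

lemma inner_cis_pos_between:
  assumes "cis s \<bullet> d > 0" "cis t \<bullet> d > 0" "s \<le> m" "m \<le> t" "t < s + pi"
  shows "cis m \<bullet> d > 0"
proof (cases "s = t")
  case False
  then have pos: "sin (t - s) > 0" using assms by (intro sin_gt_zero) auto
  have "sin (t - s) * (cis m \<bullet> d) = sin (t - m) * (cis s \<bullet> d) + sin (m - s) * (cis t \<bullet> d)"
    by (rule sin_inner_cis_combination)
  also have "\<dots> > 0"
  proof (cases "m = s")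
    case True
    then show ?thesis using pos assms by simp
  next
    case False
    then have "sin (m - s) > 0" using assms by (intro sin_gt_zero) auto
    moreover have "sin (t - m) \<ge> 0" using assms by (intro sin_ge_zero) auto
    ultimately show ?thesis using assms by (intro add_nonneg_pos mult_pos_pos mult_nonneg_nonneg) auto
  qed
  finally show ?thesis using pos by (simp add: zero_less_mult_iff)
qed (use assms in auto)

lemma diameter_closed_segment:
  fixes a b :: "'a :: euclidean_space"
  shows "diameter (closed_segment a b) = norm (b - a)"
proof (rule antisym)
  show "diameter (closed_segment a b) \<le> norm (b - a)"
  proof (rule diameter_le)
    fix x y assume "x \<in> closed_segment a b" "y \<in> closed_segment a b"
    then obtain u v where uv: "x = (1 - u) *\<^sub>R a + u *\<^sub>R b" "0 \<le> u" "u \<le> 1"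
      "y = (1 - v) *\<^sub>R a + v *\<^sub>R b" "0 \<le> v" "v \<le> 1" by (auto simp: in_segment)
    have "x - y = (u - v) *\<^sub>R (b - a)" unfolding uv(1,4) by (simp add: algebra_simps)
    then have "norm (x - y) = \<bar>u - v\<bar> * norm (b - a)" by simp
    also have "\<dots> \<le> 1 * norm (b - a)" using uv by (intro mult_right_mono) auto
    finally show "norm (x - y) \<le> norm (b - a)" by simp
  qed simp
  show "norm (b - a) \<le> diameter (closed_segment a b)"
    using diameter_bounded_bound[OF bounded_closed_segment, of b a b] by (simp add: dist_norm)
qed

context reuleaux_body
begin

text \<open>The difference \<open>d\<close> has positive product with \<open>cis v\<close> and
  \<open>cis (u + pi)\<close>, and \<open>m\<close> lies between these angles. So height in
  direction \<open>cis m\<close> grows along the boundary up to \<open>m\<close>.\<close>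

lemma supp_mono_left:
  assumes "m - pi \<le> u" "u \<le> v" "v \<le> m" "supp u \<noteq> supp v"
  shows "cis m \<bullet> supp u < cis m \<bullet> supp v"
proof -
  define d where "d = supp v - supp u"
  have 1: "cis v \<bullet> d > 0"
    using supp_strict[OF supp_in assms(4)] by (simp add: d_def inner_diff_right)
  have "cis u \<bullet> d < 0"
    using supp_strict[OF supp_in assms(4)[symmetric]] by (simp add: d_def inner_diff_right)
  moreover have "cis (u + pi) = - cis u" by (simp flip: cis_mult)
  ultimately have 2: "cis (u + pi) \<bullet> d > 0" by simp
  have "u \<noteq> v" using assms(4) by blast
  then have "cis m \<bullet> d > 0"
    using inner_cis_pos_between[OF 1 2] assms by simp
  then show ?thesis by (simp add: d_def inner_diff_right)
qed

lemma supp_mono_right: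
  assumes "m \<le> u" "u \<le> v" "v \<le> m + pi" "supp u \<noteq> supp v"
  shows "cis m \<bullet> supp v < cis m \<bullet> supp u"
proof -
  define d where "d = supp u - supp v"
  have 1: "cis u \<bullet> d > 0"
    using supp_strict[OF supp_in assms(4)[symmetric]] by (simp add: d_def inner_diff_right)
  have "cis v \<bullet> d < 0"
    using supp_strict[OF supp_in assms(4)] by (simp add: d_def inner_diff_right)
  moreover have "cis (v - pi) = - cis v" by (simp flip: cis_divide)
  ultimately have 2: "cis (v - pi) \<bullet> d > 0" by simp
  have "u \<noteq> v" using assms(4) by blast
  then have "cis m \<bullet> d > 0"
    using inner_cis_pos_between[OF 2 1] assms by simp
  then show ?thesis by (simp add: d_def inner_diff_right)
qed

lemma frontier_imp_supp_near:
  assumes "z \<in> frontier R"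
  obtains t where "z = supp t" "m - pi \<le> t" "t \<le> m + pi"
proof -
  obtain s where s: "z = supp s" using frontier_imp_supp[OF assms] .
  define k where "k = - \<lfloor>(s - m + pi) / (2 * pi)\<rfloor>"
  have "of_int (- k) \<le> (s - m + pi) / (2 * pi)" "(s - m + pi) / (2 * pi) < of_int (- k) + 1"
    unfolding k_def by linarith+
  then have "m - pi \<le> s + 2 * pi * of_int k" "s + 2 * pi * of_int k \<le> m + pi"
    using pi_gt_zero by (simp_all add: field_simps)
  then show thesis using that[of "s + 2 * pi * of_int k"] s by (simp add: supp_periodic_int)
qed

end

locale reinhardt_body =
  fixes R P :: "complex set" and n :: nat
  assumes inscribed: "reinhardt_inscribed P R"
    and polygon: "convex_polygon n P"
    and equi: "equilateral P"
begin

sublocale reuleaux_body R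
  using inscribed by unfold_locales (simp add: reinhardt_inscribed_def)

abbreviation "V \<equiv> vertices P"

lemma polytope: "polytope P" and aff_dim_P: "aff_dim P = 2" and card_sides: "card (sides P) = n"
  using polygon by (simp_all add: convex_polygon_def)

lemma V_frontier: "V \<subseteq> frontier R" and RV_V: "RV \<subseteq> V"
  using inscribed by (simp_all add: reinhardt_inscribed_def)

lemma finite_V: "finite V"
  unfolding vertices_def
  by (rule finite_polyhedron_extreme_points[OF polytope_imp_polyhedron[OF polytope]])

lemma P_hull: "P = convex hull V"
  unfolding vertices_def
  by (rule Krein_Milman_Minkowski[OF polytope_imp_compact[OF polytope] polytope_imp_convex[OF polytope]])

lemma V_P: "V \<subseteq> P"
  by (auto simp: vertices_def extreme_point_of_def)

lemma P_R: "P \<subseteq> R"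
proof -
  have "V \<subseteq> R" using V_frontier frontier_R by blast
  then have "convex hull V \<subseteq> R" using convex by (rule hull_minimal)
  then show ?thesis by (rule ord_eq_le_trans[OF P_hull])
qed

lemma face_hull:
  assumes "F face_of P"
  shows "F = convex hull (V \<inter> F)"
proof -
  have "F = convex hull {x. x extreme_point_of F}"
    using face_of_polytope_polytope[OF polytope assms]
    by (intro Krein_Milman_Minkowski polytope_imp_compact polytope_imp_convex)
  moreover have "{x. x extreme_point_of F} = V \<inter> F"
    using extreme_point_of_face[OF assms] by (auto simp: vertices_def)
  ultimately show ?thesis by simp
qed

text \<open>Height in direction \<open>cis m\<close> is unimodal along the boundary with its peak
  over the gap, so any other vertex is lower than the end of the gap on its side.\<close>

lemma gap_face:
  assumes m: "t < m" "m < t'" and btw: "\<And>u. t < u \<Longrightarrow> u < t' \<Longrightarrow> supp u \<notin> V"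
    and y: "y \<in> V" "y \<noteq> supp t" "y \<noteq> supp t'"
  shows "cis m \<bullet> y < cis m \<bullet> supp t \<or> cis m \<bullet> y < cis m \<bullet> supp t'"
proof -
  obtain u where u: "y = supp u" "m - pi \<le> u" "u \<le> m + pi"
    using frontier_imp_supp_near[of y m] y(1) V_frontier by blast
  have "\<not> (t < u \<and> u < t')" using btw[of u] y(1) u(1) by blast
  then consider "u \<le> t" | "t' \<le> u" by linarith
  then show ?thesis
  proof cases
    case 1
    then show ?thesis using supp_mono_left[of m u t] u m y(2) by auto
  next
    case 2
    then show ?thesis using supp_mono_right[of m t' u] u m y(3) by auto
  qed
qed

lemma gap_const:
  assumes "t < t'" "\<And>u. t < u \<Longrightarrow> u < t' \<Longrightarrow> supp u \<notin> V" "t \<le> u" "u \<le> t'"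
  shows "supp (u + pi) = supp (t + pi)"
proof (rule constant_on_Icc_of_finite_range[of "\<lambda>u. supp (u + pi)" t t' V])
  show "continuous_on UNIV (\<lambda>u. supp (u + pi))"
    by (intro continuous_on_compose2[OF continuous_supp] continuous_intros) auto
  show "supp (u + pi) \<in> V" if "t < u" "u < t'" for u
    using supp_cover[of u] assms(2)[OF that] RV_V by auto
qed (use assms finite_V in auto)

text \<open>Over a gap the boundary is an arc of radius \<open>w\<close> about a fixed point, which
  gives the chord length. Both ends have equal height in the middle direction \<open>m\<close> and
  all other vertices are lower, so the chord is a face of \<open>P\<close>.\<close>

lemma gap_edge:
  assumes gap: "t < t'" "supp t \<in> V" "supp t' \<in> V" "\<And>u. t < u \<Longrightarrow> u < t' \<Longrightarrow> supp u \<notin> V"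
  shows "t' - t < pi" "closed_segment (supp t) (supp t') \<in> sides P"
    "norm (supp t' - supp t) = 2 * w * sin ((t' - t) / 2)"
    "\<And>y. y \<in> P \<Longrightarrow> cis ((t + t') / 2) \<bullet> y \<le> cis ((t + t') / 2) \<bullet> supp t"
proof -
  define c where "c = supp (t + pi)"
  have sc: "supp u = c + of_real w * cis u" if "t \<le> u" "u \<le> t'" for u
  proof -
    have "supp u - of_real w * cis u = c"
      using gap_const[OF gap(1,4) that] by (simp add: c_def supp_antipodal[of u])
    then show ?thesis by (metis diff_add_cancel)
  qed
  show lt: "t' - t < pi"
  proof (rule ccontr)
    assume "\<not> t' - t < pi"
    then have "supp (t + pi + pi) = supp (t + pi)" using gap_const[OF gap(1,4), of "t + pi"] by simp
    then show False using antipodal_neq by blast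
  qed
  define m where "m = (t + t') / 2"
  define d where "d = (t' - t) / 2"
  have td: "t = m - d" "t' = m + d" by (simp_all add: m_def d_def field_simps)
  have d: "0 < d" "d < pi / 2" using gap(1) lt by (simp_all add: d_def)
  have sind: "sin d > 0" using d by (intro sin_gt_zero) auto
  have diff: "supp t' - supp t = of_real (2 * w * sin d) * (\<i> * cis m)"
    using sc[of t] sc[of t'] gap(1) unfolding td
    by (simp add: complex_eq_iff cos_add cos_diff sin_add sin_diff algebra_simps)
  then show n: "norm (supp t' - supp t) = 2 * w * sin ((t' - t) / 2)"
    using sind w_pos by (simp add: norm_mult d_def)
  have ne: "supp t \<noteq> supp t'" using n sind w_pos by (auto simp: d_def)
  have eq: "cis m \<bullet> supp t = cis m \<bullet> supp t'"
    using sc[of t] sc[of t'] gap(1) by (simp add: inner_add_right inner_cis_cis td)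
  have mt: "t < m" "m < t'" using gap(1) by (simp_all add: m_def)
  have Vle: "cis m \<bullet> y < cis m \<bullet> supp t" if "y \<in> V" "y \<noteq> supp t" "y \<noteq> supp t'" for y
    using gap_face[OF mt gap(4) that] eq by auto
  have "V \<subseteq> {y. cis m \<bullet> y \<le> cis m \<bullet> supp t}"
  proof
    fix y assume "y \<in> V"
    then show "y \<in> {y. cis m \<bullet> y \<le> cis m \<bullet> supp t}"
      using Vle[of y] eq by (cases "y = supp t \<or> y = supp t'") auto
  qed
  then have "convex hull V \<subseteq> {y. cis m \<bullet> y \<le> cis m \<bullet> supp t}"
    by (intro hull_minimal convex_halfspace_le)
  then have "P \<subseteq> {y. cis m \<bullet> y \<le> cis m \<bullet> supp t}"
    by (rule ord_eq_le_trans[OF P_hull])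
  then show le: "cis ((t + t') / 2) \<bullet> y \<le> cis ((t + t') / 2) \<bullet> supp t" if "y \<in> P" for y
    using that by (auto simp: m_def)
  define F where "F = P \<inter> {y. cis m \<bullet> y = cis m \<bullet> supp t}"
  have F: "F face_of P" unfolding F_def
    using le by (intro face_of_Int_supporting_hyperplane_le polytope_imp_convex polytope) (simp add: m_def)
  have "V \<inter> F = {supp t, supp t'}"
    using Vle V_P gap(2,3) eq unfolding F_def by fastforce
  then have "F = closed_segment (supp t) (supp t')"
    using face_hull[OF F] by (simp add: segment_convex_hull)
  moreover have "aff_dim (closed_segment (supp t) (supp t')) = 1"
    using ne by (simp only: segment_convex_hull aff_dim_convex_hull aff_dim_2 if_False)
  ultimately show "closed_segment (supp t) (supp t') \<in> sides P"
    using F by (simp add: sides_def edge_of_def)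
qed

definition side_length :: real where "side_length = (SOME s. \<forall>e\<in>sides P. diameter e = s)"

text \<open>Inverts the chord formula \<open>side_length = 2 * w * sin (angle / 2)\<close>.\<close>

definition angle :: real where "angle = 2 * arcsin (side_length / (2 * w))"

lemma diameter_side: "e \<in> sides P \<Longrightarrow> diameter e = side_length"
proof -
  have "\<exists>s. \<forall>e\<in>sides P. diameter e = s" using equi by (simp add: equilateral_def)
  then have "\<forall>e\<in>sides P. diameter e = side_length" unfolding side_length_def by (rule someI_ex)
  then show "e \<in> sides P \<Longrightarrow> diameter e = side_length" by blast
qed

lemma gap_angle:
  assumes "t < t'" "supp t \<in> V" "supp t' \<in> V" "\<And>u. t < u \<Longrightarrow> u < t' \<Longrightarrow> supp u \<notin> V"
  shows "t' - t = angle"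
proof -
  have "side_length = 2 * w * sin ((t' - t) / 2)"
    using diameter_side[OF gap_edge(2)[OF assms]] gap_edge(3)[OF assms]
    by (simp add: diameter_closed_segment)
  then have "side_length / (2 * w) = sin ((t' - t) / 2)" using w_pos by simp
  moreover have "arcsin (sin ((t' - t) / 2)) = (t' - t) / 2"
    using gap_edge(1)[OF assms] assms(1) by (intro arcsin_sin) auto
  ultimately show ?thesis by (simp add: angle_def)
qed

sublocale curve: reuleaux_curve supp w RV V angle
proof
  show "supp u = supp s" if "supp s = supp t" "s < t" "t < s + pi" "s \<le> u" "u \<le> t" for s t u
    using corner_const[OF that] .
  show "t - s = angle" if "s < t" "supp s \<in> V" "supp t \<in> V"
    "\<And>u. s < u \<Longrightarrow> u < t \<Longrightarrow> supp u \<notin> V" for s t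
    using gap_angle[OF that] .
qed (use w_pos supp_antipodal continuous_supp RV_eq finite_V RV_V supp_cover in auto)

abbreviation "T \<equiv> curve.T"
abbreviation "h \<equiv> curve.h"
abbreviation "c \<equiv> curve.c"
abbreviation "N \<equiv> curve.N"

section \<open>Sides of the polygon as arc tiles\<close>

definition seg :: "nat \<Rightarrow> complex set" where
  "seg k = closed_segment (supp (T k)) (supp (T (Suc k)))"

lemma node_V: "supp (T k) \<in> V"
  using curve.node_T by (simp add: curve.node_def)

lemma arc_gap:
  assumes "h k = 1"
  shows "T k < T (Suc k)" "\<And>u. T k < u \<Longrightarrow> u < T (Suc k) \<Longrightarrow> supp u \<notin> V"
proof -
  have "curve.arc (T k)" using assms by (simp add: curve.h_def split: if_splits)
  then show "\<And>u. T k < u \<Longrightarrow> u < T (Suc k) \<Longrightarrow> supp u \<notin> V"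
    using curve.arcD1 by (simp add: curve.T_Suc)
  show "T k < T (Suc k)" using curve.a_bounds by (simp add: curve.T_Suc)
qed

lemma seg_side: "h k = 1 \<Longrightarrow> seg k \<in> sides P"
  unfolding seg_def using gap_edge(2)[OF arc_gap(1) node_V node_V arc_gap(2)] .

text \<open>The side is exposed by some direction \<open>v\<close>. The support point of
  \<open>R\<close> in this direction is no vertex of \<open>P\<close>, or the face would be at most
  that point; so the direction lies inside an arc tile, and \<open>gap_face\<close> leaves only its
  two ends as vertices on \<open>e\<close>.\<close>

lemma side_imp_seg:
  assumes "e \<in> sides P"
  obtains k where "k < 2 * N" "h k = 1" "e = seg k"
proof -
  have e: "e face_of P" "aff_dim e = 1" using assms by (simp_all add: sides_def edge_of_def)
  have "e exposed_face_of P"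
    using e(1) exposed_face_of_polyhedron[OF polytope_imp_polyhedron[OF polytope]] by blast
  then obtain v b where vb: "P \<subseteq> {y. v \<bullet> y \<le> b}" "e = P \<inter> {y. v \<bullet> y = b}"
    unfolding exposed_face_of_def by blast
  have v0: "v \<noteq> 0"
  proof
    assume "v = 0"
    then have "e = P \<or> e = {}" using vb by auto
    then show False using e(2) aff_dim_P by auto
  qed
  obtain \<theta>0 where "v = of_real (norm v) * cis \<theta>0" by (rule complex_polar)
  then have v\<theta>0: "v = norm v *\<^sub>R cis \<theta>0" by (simp add: scaleR_conv_of_real)
  \<comment> \<open>The direction is moved beyond \<open>t0\<close>, where tiles are indexed, and
    then back by full turns to an index below \<open>2 * N\<close>.\<close>
  define i where "i = nat \<lceil>(curve.t0 - \<theta>0) / (2 * pi)\<rceil>"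
  define \<theta>1 where "\<theta>1 = \<theta>0 + 2 * pi * real i"
  have "(curve.t0 - \<theta>0) / (2 * pi) \<le> real i" by (simp add: i_def of_nat_ceiling)
  then have \<theta>1: "curve.t0 \<le> \<theta>1" by (simp add: \<theta>1_def field_simps)
  have "cis \<theta>1 = cis \<theta>0" by (simp add: \<theta>1_def cis_2pi_nat flip: cis_mult)
  then have v1: "v = norm v *\<^sub>R cis \<theta>1" using v\<theta>0 by simp
  obtain j where j: "T j \<le> \<theta>1" "\<theta>1 < T (Suc j)" using curve.tile_cover[OF \<theta>1] .
  define k where "k = j mod (2 * N)"
  define \<theta> where "\<theta> = \<theta>1 - 2 * pi * real (j div (2 * N))"
  have N0: "0 < N" using curve.N_gt_1 by simp
  have jk: "j = k + 2 * N * (j div (2 * N))" by (simp add: k_def)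
  have "T (l + 2 * N * r) = T l + 2 * pi * real r" for l r
    using curve.N_a by (simp add: curve.T_add algebra_simps)
  then have Tj: "T j = T k + 2 * pi * real (j div (2 * N))"
    "T (Suc j) = T (Suc k) + 2 * pi * real (j div (2 * N))"
    using jk by (metis, metis add_Suc)
  then have \<theta>: "T k \<le> \<theta>" "\<theta> < T (Suc k)" using j by (simp_all add: \<theta>_def)
  have "cis \<theta> = cis \<theta>1" by (simp add: \<theta>_def cis_2pi_nat flip: cis_divide)
  then have v: "v = norm v *\<^sub>R cis \<theta>" using v1 by simp
  have vin: "v \<bullet> y = norm v * (cis \<theta> \<bullet> y)" for y by (metis v inner_scaleR_left)
  have nV: "supp \<theta> \<notin> V"
  proof
    assume sV: "supp \<theta> \<in> V"
    have "e \<subseteq> {supp \<theta>}"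
    proof
      fix y assume y: "y \<in> e"
      then have "y \<in> P" "v \<bullet> y = b" using vb by auto
      moreover have "v \<bullet> supp \<theta> \<le> b" using sV V_P vb(1) by blast
      ultimately have "norm v * (cis \<theta> \<bullet> supp \<theta>) \<le> norm v * (cis \<theta> \<bullet> y)"
        by (simp flip: vin)
      then have "cis \<theta> \<bullet> supp \<theta> \<le> cis \<theta> \<bullet> y" using v0 by (simp add: mult_le_cancel_left)
      then show "y \<in> {supp \<theta>}"
        using supp_strict[of y \<theta>] \<open>y \<in> P\<close> P_R by force
    qed
    then have "aff_dim e \<le> aff_dim {supp \<theta>}" by (rule aff_dim_subset)
    then show False using e(2) by simp
  qed
  then have "T k \<noteq> \<theta>" using node_V[of k] by auto
  then have \<theta>': "T k < \<theta>" using \<theta>(1) by simp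
  have hk: "h k = 1"
  proof (rule ccontr)
    assume "h k \<noteq> 1"
    then have "h k = -1" using curve.h_sign by blast
    then have "supp \<theta> = c k" using curve.corner_center \<theta> by simp
    then show False using nV curve.c_in_RV RV_V by auto
  qed
  have sub: "V \<inter> e \<subseteq> {supp (T k), supp (T (Suc k))}"
  proof
    fix y assume y: "y \<in> V \<inter> e"
    show "y \<in> {supp (T k), supp (T (Suc k))}"
    proof (rule ccontr)
      assume "y \<notin> {supp (T k), supp (T (Suc k))}"
      then have "cis \<theta> \<bullet> y < cis \<theta> \<bullet> supp (T k) \<or> cis \<theta> \<bullet> y < cis \<theta> \<bullet> supp (T (Suc k))"
        using gap_face[OF \<theta>' \<theta>(2) arc_gap(2)[OF hk]] y by auto
      then have "b < v \<bullet> supp (T k) \<or> b < v \<bullet> supp (T (Suc k))"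
        using y v0 vb(2) by (auto simp: vin)
      moreover have "supp (T k) \<in> P" "supp (T (Suc k)) \<in> P" using node_V V_P by blast+
      ultimately show False using vb(1) by force
    qed
  qed
  have eh: "e = convex hull (V \<inter> e)" by (rule face_hull[OF e(1)])
  have "V \<inter> e = {supp (T k), supp (T (Suc k))}"
  proof (rule ccontr)
    assume "V \<inter> e \<noteq> {supp (T k), supp (T (Suc k))}"
    then obtain z where "V \<inter> e \<subseteq> {z}" using sub by blast
    then have "convex hull (V \<inter> e) \<subseteq> {z}" by (intro hull_minimal) auto
    then have "aff_dim e \<le> aff_dim {z}" using eh by (metis aff_dim_subset)
    then show False using e(2) by simp
  qed
  then have "e = seg k" using eh by (simp add: seg_def segment_convex_hull)
  moreover have "k < 2 * N" using N0 by (simp add: k_def)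
  ultimately show thesis using that hk by blast
qed

lemma vertices_seg: "vertices (seg k) = {supp (T k), supp (T (Suc k))}"
  by (auto simp: vertices_def seg_def extreme_point_of_segment)

lemma arc_start_inj:
  assumes "h k = 1" "h k' = 1" "k < k'" "k' < k + 2 * N" "supp (T k) = supp (T k')"
  shows False
proof -
  have Tl: "T i < T j" if "i < j" for i j using that curve.a_bounds by (simp add: curve.T_def)
  consider "k' < k + N" | "k' = k + N" | "k + N < k'" by linarith
  then show False
  proof cases
    case 1
    then have "T k' < T k + pi" using Tl[OF 1] by (simp add: curve.T_N)
    then show False
      using curve.not_const_arc[of k "T k" "T k'" "T k"] assms Tl[OF assms(3)] Tl[of k "Suc k"] node_V
      by simp
  next
    case 2
    then show False using assms(5) antipodal_neq[of "T k"] by (simp add: curve.T_N)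
  next
    case 3
    have "T k + 2 * pi < T k' + pi" using Tl[OF 3] by (simp add: curve.T_N)
    moreover have "T k' < T k + 2 * pi" using Tl[OF assms(4)] by (simp only: curve.T_2N)
    ultimately show False
      using curve.not_const_arc[of k' "T k'" "T k + 2 * pi" "T k'"] assms Tl[of k' "Suc k'"] node_V
        curve.periodic[of "T k"] by simp
  qed
qed

text \<open>Segments with the same first end are separated by \<open>arc_start_inj\<close>. Reversed
  segments have opposite edge vectors, which gives \<open>k = j + N\<close>, and then one of the two
  is a corner tile.\<close>

lemma seg_inj: "inj_on seg {k. k < 2 * N \<and> h k = 1}"
proof (rule linorder_inj_onI')
  fix j k assume jk: "j \<in> {k. k < 2 * N \<and> h k = 1}" "k \<in> {k. k < 2 * N \<and> h k = 1}" "j < k"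
  show "seg j \<noteq> seg k"
  proof
    assume "seg j = seg k"
    then have "{supp (T j), supp (T (Suc j))} = {supp (T k), supp (T (Suc k))}"
      by (metis vertices_seg)
    moreover have "supp (T j) \<noteq> supp (T k)" using arc_start_inj[of j k] jk by auto
    ultimately have eq: "supp (T j) = supp (T (Suc k))" "supp (T (Suc j)) = supp (T k)"
      by (auto simp: doubleton_eq_iff)
    have step: "supp (T (Suc i)) - supp (T i) = of_real w * (cis angle - 1) * cis (T i)" if "h i = 1" for i
    proof -
      have "supp (T (Suc i) + pi) = supp (T i + pi)"
        using curve.arc_center[OF that] arc_gap(1)[OF that] by simp
      then have "supp (T (Suc i)) - supp (T i) = of_real w * (cis (T (Suc i)) - cis (T i))"
        unfolding supp_antipodal by (simp add: algebra_simps)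
      also have "cis (T (Suc i)) = cis (T i) * cis angle" by (simp add: curve.T_Suc cis_mult)
      finally show ?thesis by (simp add: algebra_simps)
    qed
    have "of_real w * (cis angle - 1) * (cis (T j) + cis (T k)) =
        (supp (T (Suc j)) - supp (T j)) + (supp (T (Suc k)) - supp (T k))"
      using step[of j] step[of k] jk by (simp add: distrib_left)
    also have "\<dots> = 0" unfolding eq by simp
    finally have "of_real w * (cis angle - 1) * (cis (T j) + cis (T k)) = 0" .
    moreover have "cis angle \<noteq> 1"
      using cis_eq_imp_eq[of angle 0] curve.a_bounds by auto
    ultimately have "cis (T k) = - cis (T j)" using w_pos by (simp add: add_eq_0_iff)
    also have "\<dots> = cis (T (j + N))" by (simp add: curve.T_N flip: cis_mult)
    finally have "cis (T k) = cis (T (j + N))" .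
    moreover have "\<bar>T k - T (j + N)\<bar> < 2 * pi"
    proof -
      have "T j < T k" "T k < T (j + 2 * N)"
        using jk curve.a_bounds by (simp_all add: curve.T_def)
      then show ?thesis by (simp add: curve.T_N curve.T_2N)
    qed
    ultimately have "T k = T (j + N)" by (rule cis_eq_imp_eq)
    then have "k = j + N" using curve.a_bounds by (simp add: curve.T_def)
    then show False using jk curve.h_antiperiodic[of j] by simp
  qed
qed

lemma sides_eq: "sides P = seg ` {k. k < 2 * N \<and> h k = 1}"
  using seg_side by (auto elim: side_imp_seg)

text \<open>Exactly one of the tiles \<open>j\<close> and \<open>j + N\<close> is an arc tile, and
  both have the same centre.\<close>

lemma card_arcs_center:
  "card {k. k < 2 * N \<and> h k = 1 \<and> Q (c k)} = card {j. j < N \<and> Q (c j)}"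
proof -
  have N0: "0 < N" using curve.N_gt_1 by simp
  have "bij_betw (\<lambda>k. k mod N) {k. k < 2 * N \<and> h k = 1 \<and> Q (c k)} {j. j < N \<and> Q (c j)}"
  proof (rule bij_betw_byWitness[where f' = "\<lambda>j. if h j = 1 then j else j + N"])
    show "\<forall>k\<in>{k. k < 2 * N \<and> h k = 1 \<and> Q (c k)}. (if h (k mod N) = 1 then k mod N else k mod N + N) = k"
    proof
      fix k assume k: "k \<in> {k. k < 2 * N \<and> h k = 1 \<and> Q (c k)}"
      show "(if h (k mod N) = 1 then k mod N else k mod N + N) = k"
      proof (cases "k < N")
        case False
        have "k - N < N" using k by auto
        then have "k mod N = k - N" using False by (simp add: le_mod_geq)
        then show ?thesis using False k curve.h_antiperiodic[of "k - N"] by simp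
      qed (use k in simp)
    qed
    show "\<forall>j\<in>{j. j < N \<and> Q (c j)}. (if h j = 1 then j else j + N) mod N = j" by auto
    show "(\<lambda>k. k mod N) ` {k. k < 2 * N \<and> h k = 1 \<and> Q (c k)} \<subseteq> {j. j < N \<and> Q (c j)}"
      using N0 by (auto simp: curve.c_mod)
    show "(\<lambda>j. if h j = 1 then j else j + N) ` {j. j < N \<and> Q (c j)}
        \<subseteq> {k. k < 2 * N \<and> h k = 1 \<and> Q (c k)}"
      using curve.h_sign curve.h_antiperiodic curve.c_periodic by force
  qed
  then show ?thesis by (rule bij_betw_same_card)
qed

lemma N_eq: "N = n"
proof -
  have "n = card {k. k < 2 * N \<and> h k = 1}"
    using card_sides card_image[OF seg_inj] by (simp add: sides_eq)
  also have "\<dots> = N" using card_arcs_center[of "\<lambda>_. True"] by simp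
  finally show ?thesis by simp
qed

text \<open>Only \<open>c k\<close> and its mirror image in the line of the segment have distance
  \<open>w\<close> from both ends, and the mirror image lies beyond that line, where
  \<open>P\<close> has no points. The coordinates of \<open>v - c k\<close> along and across the
  axis of symmetry are \<open>l\<close> and \<open>r\<close>.\<close>

lemma seg_center_unique:
  assumes hk: "h k = 1" and v: "v \<in> V"
    and dist: "dist v (supp (T k)) = w" "dist v (supp (T (Suc k))) = w"
  shows "c k = v"
proof -
  define m where "m = (T k + T (Suc k)) / 2"
  define \<delta> where "\<delta> = angle / 2"
  have T: "T k = m - \<delta>" "T (Suc k) = m + \<delta>" by (simp_all add: m_def \<delta>_def curve.T_Suc field_simps)
  have p: "supp (T k) = c k + of_real w * cis (m - \<delta>)" "supp (T (Suc k)) = c k + of_real w * cis (m + \<delta>)"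
    using curve.arc_center[OF hk, of "T k"] curve.arc_center[OF hk, of "T (Suc k)"] arc_gap(1)[OF hk]
    unfolding supp_antipodal T by (simp_all add: algebra_simps)
  define d where "d = v - c k"
  have sq: "(norm d)\<^sup>2 = 2 * w * (cis s \<bullet> d)" if "dist v (c k + of_real w * cis s) = w" for s
  proof -
    have "norm (d - of_real w * cis s) = w" using that by (simp add: d_def dist_norm algebra_simps)
    then have "(norm (d - of_real w * cis s))\<^sup>2 = w\<^sup>2" by simp
    moreover have "(norm (of_real w * cis s))\<^sup>2 = w\<^sup>2" by (simp add: norm_mult)
    moreover have "(norm (d - of_real w * cis s))\<^sup>2 =
        (norm d)\<^sup>2 - 2 * (d \<bullet> (of_real w * cis s)) + (norm (of_real w * cis s))\<^sup>2"
      by (simp add: power2_norm_eq_inner inner_diff_left inner_diff_right inner_commute)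
    moreover have "d \<bullet> (of_real w * cis s) = w * (cis s \<bullet> d)"
      by (simp add: inner_complex_def algebra_simps)
    ultimately show ?thesis by simp
  qed
  have s1: "(norm d)\<^sup>2 = 2 * w * (cis (m - \<delta>) \<bullet> d)" and s2: "(norm d)\<^sup>2 = 2 * w * (cis (m + \<delta>) \<bullet> d)"
    using sq[of "m - \<delta>"] sq[of "m + \<delta>"] dist unfolding p by blast+
  define l where "l = cis m \<bullet> d"
  define r where "r = (\<i> * cis m) \<bullet> d"
  have e: "cis (m - \<delta>) \<bullet> d = cos \<delta> * l - sin \<delta> * r" "cis (m + \<delta>) \<bullet> d = cos \<delta> * l + sin \<delta> * r"
    by (simp_all add: l_def r_def inner_complex_def cos_add cos_diff sin_add sin_diff algebra_simps)
  have \<delta>: "0 < \<delta>" "\<delta> < pi / 2" using curve.a_bounds by (simp_all add: \<delta>_def)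
  have "sin \<delta> > 0" "cos \<delta> > 0" using \<delta> by (auto intro!: sin_gt_zero cos_gt_zero_pi)
  moreover have "w * (sin \<delta> * r) = 0" using s1 s2 unfolding e by (simp add: algebra_simps)
  ultimately have r0: "r = 0" using w_pos by simp
  have "(norm d)\<^sup>2 = ((cos m)\<^sup>2 + (sin m)\<^sup>2) * ((Re d)\<^sup>2 + (Im d)\<^sup>2)" by (simp add: cmod_power2)
  also have "\<dots> = l\<^sup>2 + r\<^sup>2"
  proof -
    have "l = cos m * Re d + sin m * Im d" "r = cos m * Im d - sin m * Re d"
      by (simp_all add: l_def r_def inner_complex_def)
    then show ?thesis by algebra
  qed
  finally have nl: "(norm d)\<^sup>2 = l\<^sup>2" using r0 by simp
  have "cis m \<bullet> v \<le> cis m \<bullet> supp (T k)"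
    unfolding m_def using gap_edge(4)[OF arc_gap(1)[OF hk] node_V node_V arc_gap(2)[OF hk]] v V_P by blast
  then have "l \<le> w * cos \<delta>"
    unfolding p l_def d_def by (simp add: inner_add_right inner_diff_right inner_cis_cis)
  moreover have "l * (l - 2 * w * cos \<delta>) = 0"
  proof -
    have "l\<^sup>2 = 2 * w * (cos \<delta> * l)" using s1 nl r0 unfolding e by simp
    then show ?thesis by algebra
  qed
  moreover have "w * cos \<delta> > 0" using w_pos \<open>cos \<delta> > 0\<close> by simp
  ultimately have "l = 0" by auto
  then have "d = 0" using nl by simp
  then show ?thesis by (simp add: d_def)
qed

text \<open>The sides opposite to \<open>c b\<close> are those whose arc has centre
  \<open>c b\<close>; \<open>card_arcs_center\<close> converts their count over a full turn into one
  over half a turn.\<close>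

lemma sides_opposite_center: "sides_opposite P R (c b) = card {j. j < N \<and> c j = c b}"
proof -
  have "vertices (seg k) \<subseteq> opposite_arc R (c b) \<longleftrightarrow> c k = c b" if "h k = 1" for k
  proof
    assume "vertices (seg k) \<subseteq> opposite_arc R (c b)"
    then show "c k = c b"
      using seg_center_unique[OF that] curve.c_in_RV RV_V
      by (auto simp: vertices_seg opposite_arc_def)
  next
    assume eq: "c k = c b"
    have "dist (c k) (supp u) = w" if "T k \<le> u" "u \<le> T (Suc k)" for u
    proof -
      have "c k = supp u - of_real w * cis u"
        using curve.arc_center[OF \<open>h k = 1\<close> that] unfolding supp_antipodal by simp
      then show ?thesis using w_pos by (simp add: dist_norm norm_mult)
    qed
    then show "vertices (seg k) \<subseteq> opposite_arc R (c b)"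
      using arc_gap(1)[OF that] supp_frontier eq by (auto simp: vertices_seg opposite_arc_def)
  qed
  then have "{e \<in> sides P. vertices e \<subseteq> opposite_arc R (c b)} = seg ` {k. k < 2 * N \<and> h k = 1 \<and> c k = c b}"
    unfolding sides_eq by auto
  moreover have "inj_on seg {k. k < 2 * N \<and> h k = 1 \<and> c k = c b}"
    using seg_inj by (rule inj_on_subset) auto
  ultimately show ?thesis
    unfolding sides_opposite_def using card_arcs_center[of "\<lambda>v. v = c b"] by (simp add: card_image)
qed

lemma star_segments_eq: "star_segments R = {{c k, c (Suc k)} | k. curve.breakpoint k}"
proof (intro equalityI subsetI)
  fix e assume "e \<in> star_segments R"
  then obtain u v where uv: "e = {u, v}" "u \<in> RV" "v \<in> RV" "dist u v = w"
    unfolding star_segments_def by blast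
  have "u \<in> R" "v \<in> R" using uv RV_frontier frontier_R by blast+
  then obtain t where t: "u = supp t" "v = supp (t + pi)"
    using dist_w_imp_antipodal uv(4) by blast
  obtain k where "curve.breakpoint k" "{supp t, supp (t + pi)} = {c k, c (Suc k)}"
    using curve.antipodal_vertices[of t] uv t by blast
  then show "e \<in> {{c k, c (Suc k)} | k. curve.breakpoint k}" using uv t by blast
next
  fix e assume "e \<in> {{c k, c (Suc k)} | k. curve.breakpoint k}"
  then show "e \<in> star_segments R"
    unfolding star_segments_def using curve.c_in_RV curve.dist_center_step by blast
qed

lemma rotational_imp_periodic:
  assumes "\<And>k. h (k + q) = - h k" "n = m * q" "m > 1"
  shows "periodic_polygon P"
proof -
  have "N = m * q" using N_eq assms(2) by (rule trans)
  then obtain vs ks where vs: "distinct vs" "set vs = RV"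
    "{{vs ! i, vs ! (Suc i mod length vs)} | i. i < length vs} = {{c k, c (Suc k)} | k. curve.breakpoint k}"
    "map (sides_opposite P R) vs = concat (replicate m ks)"
    using curve.periodic_centers[OF assms(1) _ sides_opposite_center, of m] by auto
  have "star_traversal R vs"
    unfolding star_traversal_def vs(3) star_segments_eq using vs(1,2) by (intro conjI refl)
  moreover have "dihedral_equiv (map (sides_opposite P R) vs) (concat (replicate m ks))"
    unfolding dihedral_equiv_def vs(4) by (intro exI[of _ 0]) simp
  ultimately have "concat (replicate m ks) \<in> dihedral_composition P"
    unfolding dihedral_composition_def using inscribed
    by (intro CollectI exI[of _ R] exI[of _ vs] conjI)
  then show ?thesis unfolding periodic_polygon_def using assms(3) by blast
qed

end

theorem theorem1p1:
  fixes n p q :: nat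
  assumes "prime p" and "prime q" and "odd p" and "odd q" and "p \<noteq> q"
    and "n = p * q"
  shows "(\<forall>P. reinhardt_polygon n P \<longrightarrow> periodic_polygon P) \<and> E1 n = 0"
proof -
  have periodic: "periodic_polygon P" if P: "reinhardt_polygon n P" for P
  proof -
    obtain R where "reinhardt_inscribed P R" "convex_polygon n P" "equilateral P"
      using P unfolding reinhardt_polygon_def by blast
    then interpret reinhardt_body R P n by unfold_locales
    have "(\<forall>k. h (k + p) = - h k) \<or> (\<forall>k. h (k + q) = - h k)"
      using assms curve.h_antiperiodic curve.h_sign curve.sign_sum_zero
      by (intro antiperiodic_sign_dichotomy[of p q n]) (simp_all add: N_eq)
    then show ?thesis
    proof
      \<comment> \<open>A shift by \<open>p\<close> cuts the \<open>n\<close> tiles of half a turn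
        into \<open>q\<close> blocks, so the composition repeats \<open>q\<close> times.\<close>
      assume "\<forall>k. h (k + p) = - h k"
      then show ?thesis
        using rotational_imp_periodic[of p q] assms prime_gt_1_nat by (simp add: mult.commute)
    next
      assume "\<forall>k. h (k + q) = - h k"
      then show ?thesis
        using rotational_imp_periodic[of q p] assms prime_gt_1_nat by simp
    qed
  qed
  \<comment> \<open>The cardinality is that of the empty set, not the default value 0 for infinite
    sets.\<close>
  then have "{P. sporadic_polygon n P} = {}" unfolding sporadic_polygon_def by blast
  then show ?thesis using periodic by (simp add: E1_def)
qed

end
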